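(* Let $G$ be adjoint of type $\mathbf{A}_n$, $n\ge 6$. (1) For each $m\in\mathbb{N}$ there is a section of the Weyl group such that the lift $\mathcal S(s_i)$ of every $s_i$ has order $2m$. This section is obtained by choosing the $a_{i,j}$ in any way such that $$-a_{1,1}a_{1,2}^2=-a_{2,2}a_{2,3}^2=\cdots=-a_{n-1,n-1}a_{n-1,n}^2=-a_{n,n}^{-1}a_{n,n-1}^{-2}$$ is a primitive $m$-th root of unity. In particular, any section given by $\mathcal S(s_{i})=t_i\sigma_i$ with $$a_{1,1}a_{1,2}^2=a_{2,2}a_{2,3}^2=\cdots=a_{n-1,n-1}a_{n-1,n}^2=a_{n,n}a_{n,n-1}^2=-1$$ is an optimal section (in fact a homomorphic section), whereas the Tits section $\mathcal N_\circ$ is not. Moreover $\mathcal N_\circ(s_i)^2\ne 1$ for all $i=1,\dots,n$. (2) Two sections are $T$-conjugate if and only if they have the same value of $a_{1,1}a_{1,2}^2$.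
   Context: $F$ is an algebraically closed field, $G$ an almost-simple connected reductive group over $F$, $T$ a maximal torus, $N=N_G(T)$, $W=N/T$, $\pi:N\to W$ the projection. Let $\alpha_1,\dots,\alpha_n$ be the simple roots in Bourbaki numbering, $s_i$ the corresponding reflections, $\alpha_i^\vee$ the simple coroots, $\omega_i$ the fundamental coweights. Fix a realization of the root system: isomorphisms $u_\alpha:\mathbf G_a\to U_\alpha$ onto the root subgroups with $tu_\alpha(x)t^{-1}=u_\alpha(\alpha(t)x)$, such that $\sigma_\alpha=u_\alpha(1)u_{-\alpha}(-1)u_\alpha(1)\in N$ maps to $s_\alpha$ and $u_\alpha(x)u_{-\alpha}(-x^{-1})u_\alpha(x)=\alpha^\vee(x)\sigma_\alpha$ for $x\in F^\times$; put $\sigma_i=\sigma_{\alpha_i}$. A section is a map $\mathcal S:W\to N$ with $\pi\circ\mathcal S=\mathrm{id}$ satisfying the braid relations (equivalently $\mathcal S$ is multiplicative along reduced expressions). It is determined by $\mathcal S(s_i)=t_i\sigma_i$, $t_i\in T$. The Tits section $\mathcal N_\circ$ is the one with all $t_i=1$. A section is homomorphic if it is a group homomorphism. The order profile of $\mathcal S$ is the Dynkin diagram with the node of each $\alpha_i$ labeled by the order of $\mathcal S(s_i)$. For two sections write $\mathcal S'<\mathcal S$ if the order of $\mathcal S'(s_i)$ is greater than the order of $\mathcal S(s_i)$ for all $i$; this translates to a partial order on order profiles, and a section is called optimal if it has the unique maximal order profile with respect to this partial order. Two sections $\mathcal S,\mathcal S'$ are $T$-conjugate if there is $t\in T$ with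 $t\mathcal S(w)t^{-1}=\mathcal S'(w)$ for all $w\in W$. Coordinates: $(x_1,\dots,x_n)$ denotes $\omega_1(x_1)\cdots\omega_n(x_n)\in T$. The sections are exactly those given by $t_i$ of the following form, with all $a_{i,j}\in F^\times$: $t_1=(a_{1,1},a_{1,2},1,\dots,1)$; for $2\le i\le n-1$, $t_i$ has coordinates $a_{i,i}^{-1}a_{i,i+1}^{-1},\ a_{i,i},\ a_{i,i+1}$ in positions $i-1,i,i+1$ and $1$ elsewhere; $t_n=(1,\dots,1,a_{n,n-1},a_{n,n})$; subject to $a_{1,1}a_{1,2}^2=a_{2,2}a_{2,3}^2=\cdots=a_{n-1,n-1}a_{n-1,n}^2=a_{n,n}^{-1}a_{n,n-1}^{-2}$.
   Formalization: Existence of a section with all lifts of order 2m is stated for positive m not divisible by the characteristic of F; the claims that the Tits section is not optimal and that N_∘(s_i)^2 ≠ 1 are stated for characteristic different from 2. Both fail otherwise. *)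

theory Defs
  imports
    "HOL-Computational_Algebra.Computational_Algebra"
    "HOL-Algebra.Algebra"
    "Jordan_Normal_Form.Gauss_Jordan_Elimination"
    "HOL-Library.Extended_Nat"
begin

section \<open>The adjoint group of type A and its root system\<close>

definition GL :: "nat \<Rightarrow> 'a::field mat monoid" where
  "GL d = units_of (ring_mat TYPE('a) d ())"

definition scalars :: "nat \<Rightarrow> 'a::field mat set" where
  "scalars d = {c \<cdot>\<^sub>m 1\<^sub>m d | c. c \<noteq> 0}"

definition PGL :: "nat \<Rightarrow> 'a::field mat set monoid" where
  "PGL d = GL d Mod scalars d"

definition proj_class :: "nat \<Rightarrow> 'a::field mat \<Rightarrow> 'a mat set" where
  "proj_class d A = scalars d #>\<^bsub>GL d\<^esub> A"

text \<open>
  Up to isomorphism the adjoint group of type $A_n$ over an algebraically closed field is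
  $PGL_{n+1}$, and all pairs (maximal torus, base of the roots) in it are conjugate. Hence a group
  \<open>G\<close> of this type with a chosen maximal torus and numbered simple roots is given by
  an isomorphism \<open>\<phi>\<close> from $PGL_{n+1}$ to \<open>G\<close>: the torus is the image of the diagonal matrices.
  Rows are numbered from $0$ to $n$. The roots are $\varepsilon_i - \varepsilon_j$ for $i \ne j$ in
  $0, \dots, n$, written as the pair \<open>i j\<close>, where $\varepsilon_i - \varepsilon_j$ sends the class
  of $diag(d_0, \dots, d_n)$ to $d_i / d_j$. The simple roots are
  $\alpha_k = \varepsilon_{k-1} - \varepsilon_k$ for $k = 1, \dots, n$.
\<close>

definition adjoint_type_A :: "nat \<Rightarrow> 'g monoid \<Rightarrow> ('a::field mat set \<Rightarrow> 'g) \<Rightarrow> bool" where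
  "adjoint_type_A n G \<phi> \<longleftrightarrow> group G \<and> \<phi> \<in> iso (PGL (n + 1)) G"

definition units_upto :: "nat \<Rightarrow> (nat \<Rightarrow> 'a::field) set" where
  "units_upto n = {d. \<forall>i\<le>n. d i \<noteq> 0}"

definition tor :: "nat \<Rightarrow> ('a::field mat set \<Rightarrow> 'g) \<Rightarrow> (nat \<Rightarrow> 'a) \<Rightarrow> 'g" where
  "tor n \<phi> d = \<phi> (proj_class (n + 1) (mat_diag (n + 1) d))"

definition torus :: "nat \<Rightarrow> ('a::field mat set \<Rightarrow> 'g) \<Rightarrow> 'g set" where
  "torus n \<phi> = tor n \<phi> ` units_upto n"

definition root_subgroup :: "nat \<Rightarrow> ('a::field mat set \<Rightarrow> 'g) \<Rightarrow> nat \<Rightarrow> nat \<Rightarrow> 'g set" where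
  "root_subgroup n \<phi> i j = range (\<lambda>x. \<phi> (proj_class (n + 1) (addrow_mat (n + 1) x i j)))"

definition coroot :: "nat \<Rightarrow> ('a::field mat set \<Rightarrow> 'g) \<Rightarrow> nat \<Rightarrow> nat \<Rightarrow> 'a \<Rightarrow> 'g" where
  "coroot n \<phi> i j x = tor n \<phi> (\<lambda>r. if r = i then x else if r = j then inverse x else 1)"

definition fund_coweight :: "nat \<Rightarrow> ('a::field mat set \<Rightarrow> 'g) \<Rightarrow> nat \<Rightarrow> 'a \<Rightarrow> 'g" where
  "fund_coweight n \<phi> k x = tor n \<phi> (\<lambda>r. if r < k then x else 1)"

section \<open>The Weyl group\<close>

definition norm_torus :: "nat \<Rightarrow> 'g monoid \<Rightarrow> ('a::field mat set \<Rightarrow> 'g) \<Rightarrow> 'g set" where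
  "norm_torus n G \<phi> = normalizer G (torus n \<phi>)"

definition weyl :: "nat \<Rightarrow> 'g monoid \<Rightarrow> ('a::field mat set \<Rightarrow> 'g) \<Rightarrow> 'g set monoid" where
  "weyl n G \<phi> = (G\<lparr>carrier := norm_torus n G \<phi>\<rparr>) Mod torus n \<phi>"

text \<open>
  The reflection in the root $\alpha = \varepsilon_i - \varepsilon_j$, acting on the torus by
  $t \mapsto t\,\alpha^\vee(\alpha(t))^{-1}$. The torus is its own centralizer, so the elements of the
  normalizer that induce this action form a single coset, i.e. an element of the Weyl group.
\<close>

definition reflection ::
  "nat \<Rightarrow> 'g monoid \<Rightarrow> ('a::field mat set \<Rightarrow> 'g) \<Rightarrow> nat \<Rightarrow> nat \<Rightarrow> 'g set" where
  "reflection n G \<phi> i j = {g \<in> norm_torus n G \<phi>. \<forall>d\<in>units_upto n.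
     g \<otimes>\<^bsub>G\<^esub> tor n \<phi> d \<otimes>\<^bsub>G\<^esub> inv\<^bsub>G\<^esub> g
       = tor n \<phi> d \<otimes>\<^bsub>G\<^esub> inv\<^bsub>G\<^esub> (coroot n \<phi> i j (d i / d j))}"

definition simple_refl ::
  "nat \<Rightarrow> 'g monoid \<Rightarrow> ('a::field mat set \<Rightarrow> 'g) \<Rightarrow> nat \<Rightarrow> 'g set" where
  "simple_refl n G \<phi> k = reflection n G \<phi> (k - 1) k"

definition weyl_word ::
  "nat \<Rightarrow> 'g monoid \<Rightarrow> ('a::field mat set \<Rightarrow> 'g) \<Rightarrow> nat list \<Rightarrow> 'g set" where
  "weyl_word n G \<phi> ks =
     foldr (mult (weyl n G \<phi>)) (map (simple_refl n G \<phi>) ks) (one (weyl n G \<phi>))"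

definition reduced_word ::
  "nat \<Rightarrow> 'g monoid \<Rightarrow> ('a::field mat set \<Rightarrow> 'g) \<Rightarrow> nat list \<Rightarrow> bool" where
  "reduced_word n G \<phi> ks \<longleftrightarrow> set ks \<subseteq> {1..n} \<and>
     (\<forall>ls. set ls \<subseteq> {1..n} \<and> weyl_word n G \<phi> ls = weyl_word n G \<phi> ks
        \<longrightarrow> length ks \<le> length ls)"

section \<open>Realizations\<close>

definition sigma :: "'g monoid \<Rightarrow> (nat \<Rightarrow> nat \<Rightarrow> 'a::field \<Rightarrow> 'g) \<Rightarrow> nat \<Rightarrow> nat \<Rightarrow> 'g" where
  "sigma G u i j = u i j 1 \<otimes>\<^bsub>G\<^esub> u j i (- 1) \<otimes>\<^bsub>G\<^esub> u i j 1"

definition simple_sigma :: "'g monoid \<Rightarrow> (nat \<Rightarrow> nat \<Rightarrow> 'a::field \<Rightarrow> 'g) \<Rightarrow> nat \<Rightarrow> 'g" where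
  "simple_sigma G u k = sigma G u (k - 1) k"

text \<open>
  An isomorphism of abstract groups from the additive group onto a root subgroup that is equivariant
  under the torus is $x \mapsto u(c x)$ for the standard parametrization $u$ and a constant
  $c \ne 0$, so it is automatically an isomorphism of algebraic groups.
\<close>

definition realization ::
  "nat \<Rightarrow> 'g monoid \<Rightarrow> ('a::field mat set \<Rightarrow> 'g) \<Rightarrow> (nat \<Rightarrow> nat \<Rightarrow> 'a \<Rightarrow> 'g) \<Rightarrow> bool" where
  "realization n G \<phi> u \<longleftrightarrow> (\<forall>i\<le>n. \<forall>j\<le>n. i \<noteq> j \<longrightarrow>
     (\<forall>x y. u i j (x + y) = u i j x \<otimes>\<^bsub>G\<^esub> u i j y) \<and>
     bij_betw (u i j) UNIV (root_subgroup n \<phi> i j) \<and>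
     (\<forall>d\<in>units_upto n. \<forall>x.
        tor n \<phi> d \<otimes>\<^bsub>G\<^esub> u i j x \<otimes>\<^bsub>G\<^esub> inv\<^bsub>G\<^esub> (tor n \<phi> d) = u i j (d i / d j * x)) \<and>
     sigma G u i j \<in> norm_torus n G \<phi> \<and>
     torus n \<phi> #>\<^bsub>G\<^esub> sigma G u i j = reflection n G \<phi> i j \<and>
     (\<forall>x. x \<noteq> 0 \<longrightarrow>
        u i j x \<otimes>\<^bsub>G\<^esub> u j i (- inverse x) \<otimes>\<^bsub>G\<^esub> u i j x
          = coroot n \<phi> i j x \<otimes>\<^bsub>G\<^esub> sigma G u i j))"

section \<open>Sections of the Weyl group\<close>

definition is_section ::
  "nat \<Rightarrow> 'g monoid \<Rightarrow> ('a::field mat set \<Rightarrow> 'g) \<Rightarrow> ('g set \<Rightarrow> 'g) \<Rightarrow> bool" where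
  "is_section n G \<phi> S \<longleftrightarrow>
     (\<forall>w\<in>carrier (weyl n G \<phi>). S w \<in> norm_torus n G \<phi> \<and> torus n \<phi> #>\<^bsub>G\<^esub> S w = w) \<and>
     (\<forall>ks. reduced_word n G \<phi> ks \<longrightarrow>
        S (weyl_word n G \<phi> ks)
          = foldr (mult G) (map (\<lambda>k. S (simple_refl n G \<phi> k)) ks) (one G))"

definition is_Tits_section ::
  "nat \<Rightarrow> 'g monoid \<Rightarrow> ('a::field mat set \<Rightarrow> 'g) \<Rightarrow> (nat \<Rightarrow> nat \<Rightarrow> 'a \<Rightarrow> 'g) \<Rightarrow> ('g set \<Rightarrow> 'g) \<Rightarrow> bool"
  where
  "is_Tits_section n G \<phi> u S \<longleftrightarrow>
     is_section n G \<phi> S \<and> (\<forall>i\<in>{1..n}. S (simple_refl n G \<phi> i) = simple_sigma G u i)"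

definition homomorphic_section ::
  "nat \<Rightarrow> 'g monoid \<Rightarrow> ('a::field mat set \<Rightarrow> 'g) \<Rightarrow> ('g set \<Rightarrow> 'g) \<Rightarrow> bool" where
  "homomorphic_section n G \<phi> S \<longleftrightarrow>
     is_section n G \<phi> S \<and> S \<in> hom (weyl n G \<phi>) (G\<lparr>carrier := norm_torus n G \<phi>\<rparr>)"

definition T_conjugate ::
  "nat \<Rightarrow> 'g monoid \<Rightarrow> ('a::field mat set \<Rightarrow> 'g) \<Rightarrow> ('g set \<Rightarrow> 'g) \<Rightarrow> ('g set \<Rightarrow> 'g) \<Rightarrow> bool" where
  "T_conjugate n G \<phi> S S' \<longleftrightarrow>
     (\<exists>t\<in>torus n \<phi>. \<forall>w\<in>carrier (weyl n G \<phi>). t \<otimes>\<^bsub>G\<^esub> S w \<otimes>\<^bsub>G\<^esub> inv\<^bsub>G\<^esub> t = S' w)"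

text \<open>\<^const>\<open>group.ord\<close> is $0$ on elements of infinite order.\<close>

definition order_profile ::
  "nat \<Rightarrow> 'g monoid \<Rightarrow> ('a::field mat set \<Rightarrow> 'g) \<Rightarrow> ('g set \<Rightarrow> 'g) \<Rightarrow> nat \<Rightarrow> enat" where
  "order_profile n G \<phi> S = (\<lambda>i\<in>{1..n}.
     let k = group.ord G (S (simple_refl n G \<phi> i)) in if k = 0 then \<infinity> else enat k)"

text \<open>The order is reversed: a smaller profile has larger orders at all nodes.\<close>

definition profile_less :: "nat \<Rightarrow> (nat \<Rightarrow> enat) \<Rightarrow> (nat \<Rightarrow> enat) \<Rightarrow> bool" where
  "profile_less n P Q \<longleftrightarrow> (\<forall>i\<in>{1..n}. P i > Q i)"

definition maximal_profile ::
  "nat \<Rightarrow> 'g monoid \<Rightarrow> ('a::field mat set \<Rightarrow> 'g) \<Rightarrow> (nat \<Rightarrow> enat) \<Rightarrow> bool" where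
  "maximal_profile n G \<phi> P \<longleftrightarrow>
     (\<exists>S. is_section n G \<phi> S \<and> order_profile n G \<phi> S = P) \<and>
     (\<nexists>S. is_section n G \<phi> S \<and> profile_less n P (order_profile n G \<phi> S))"

definition optimal_section ::
  "nat \<Rightarrow> 'g monoid \<Rightarrow> ('a::field mat set \<Rightarrow> 'g) \<Rightarrow> ('g set \<Rightarrow> 'g) \<Rightarrow> bool" where
  "optimal_section n G \<phi> S \<longleftrightarrow> is_section n G \<phi> S \<and>
     maximal_profile n G \<phi> (order_profile n G \<phi> S) \<and>
     (\<forall>P. maximal_profile n G \<phi> P \<longrightarrow> P = order_profile n G \<phi> S)"

section \<open>Coordinates\<close>

definition torus_point ::
  "nat \<Rightarrow> 'g monoid \<Rightarrow> ('a::field mat set \<Rightarrow> 'g) \<Rightarrow> (nat \<Rightarrow> 'a) \<Rightarrow> 'g" where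
  "torus_point n G \<phi> x =
     foldr (mult G) (map (\<lambda>k. fund_coweight n \<phi> k (x k)) [1..<n + 1]) (one G)"

definition torus_coord ::
  "nat \<Rightarrow> 'g monoid \<Rightarrow> ('a::field mat set \<Rightarrow> 'g) \<Rightarrow> nat \<Rightarrow> 'g \<Rightarrow> 'a" where
  "torus_coord n G \<phi> k t =
     (THE c. \<exists>x. (\<forall>j\<in>{1..n}. x j \<noteq> 0) \<and> torus_point n G \<phi> x = t \<and> x k = c)"

text \<open>
  The \<open>j\<close>-th coordinate of $t_i$ when the section sends $s_i$ to $t_i \sigma_i$. At the positions
  named by the parametrization \<open>t_coords\<close> below it is the parameter $a_{i,j}$ of the section.
\<close>

definition section_param ::
  "nat \<Rightarrow> 'g monoid \<Rightarrow> ('a::field mat set \<Rightarrow> 'g) \<Rightarrow> (nat \<Rightarrow> nat \<Rightarrow> 'a \<Rightarrow> 'g) \<Rightarrow> ('g set \<Rightarrow> 'g)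
     \<Rightarrow> nat \<Rightarrow> nat \<Rightarrow> 'a" where
  "section_param n G \<phi> u S i j =
     torus_coord n G \<phi> j (S (simple_refl n G \<phi> i) \<otimes>\<^bsub>G\<^esub> inv\<^bsub>G\<^esub> (simple_sigma G u i))"

definition nonzero_params :: "nat \<Rightarrow> (nat \<Rightarrow> nat \<Rightarrow> 'a::field) \<Rightarrow> bool" where
  "nonzero_params n a \<longleftrightarrow>
     (\<forall>i\<in>{1..n}. a i i \<noteq> 0) \<and> (\<forall>i\<in>{1..<n}. a i (i + 1) \<noteq> 0) \<and> a n (n - 1) \<noteq> 0"

definition t_coords :: "nat \<Rightarrow> (nat \<Rightarrow> nat \<Rightarrow> 'a::field) \<Rightarrow> nat \<Rightarrow> nat \<Rightarrow> 'a" where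
  "t_coords n a i = (
     if i = 1 then (\<lambda>_. 1)(1 := a 1 1, 2 := a 1 2)
     else if i < n then
       (\<lambda>_. 1)(i - 1 := inverse (a i i) * inverse (a i (i + 1)), i := a i i, i + 1 := a i (i + 1))
     else (\<lambda>_. 1)(n - 1 := a n (n - 1), n := a n n))"

definition section_given_by ::
  "nat \<Rightarrow> 'g monoid \<Rightarrow> ('a::field mat set \<Rightarrow> 'g) \<Rightarrow> (nat \<Rightarrow> nat \<Rightarrow> 'a \<Rightarrow> 'g)
     \<Rightarrow> (nat \<Rightarrow> nat \<Rightarrow> 'a) \<Rightarrow> ('g set \<Rightarrow> 'g) \<Rightarrow> bool" where
  "section_given_by n G \<phi> u a S \<longleftrightarrow> is_section n G \<phi> S \<and>
     (\<forall>i\<in>{1..n}. S (simple_refl n G \<phi> i)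
        = torus_point n G \<phi> (t_coords n a i) \<otimes>\<^bsub>G\<^esub> simple_sigma G u i)"

definition primitive_root_of_unity :: "nat \<Rightarrow> 'a::field \<Rightarrow> bool" where
  "primitive_root_of_unity m z \<longleftrightarrow> 0 < m \<and> z ^ m = 1 \<and> (\<forall>k. 0 < k \<and> k < m \<longrightarrow> z ^ k \<noteq> 1)"

end

theory Submission
  imports Defs
begin

text \<open>
  The normalizer of the torus of $PGL_{n+1}$ consists of the classes of monomial matrices. Such a
  class is given by a permutation \<open>w\<close> of $0, \dots, n$ and nonzero column coefficients
  $e_0, \dots, e_n$, up to a common factor, and the Weyl group is the group of the permutations
  \<open>w\<close>. So a section amounts to a choice of coefficients for every permutation.

  For a permutation \<open>w\<close> put into column \<open>j\<close> the coefficient $q^{c_j(w)}$, where $c_j(w)$ is the number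
  of inversions of \<open>w\<close> that start at \<open>j\<close>. Multiplying \<open>w\<close> from the left by a simple reflection that
  raises its length changes exactly one of the numbers $c_j(w)$, by one, and this is exactly the
  factor that the lift of the reflection contributes. Hence these monomial elements are
  multiplicative along reduced words, whatever $q \ne 0$ is (\<open>std_section_is_section\<close>). An additional
  parameter \<open>t\<close> records conjugation by the torus.

  These are all sections (\<open>section_eq_std_section\<close>). The commutation of the lifts of $s_i$ and $s_j$
  for $|i - j| \ge 2$ holds in $PGL_{n+1}$ only up to a scalar, but an index that is moved by
  neither reflection shows that the scalar is $1$. Together with the braid relation for neighbours this
  forces the coefficients of the lift of $s_k$ to be constant outside $\{k - 1, k\}$. After scaling
  the constant to $1$, the braid relation says that the product \<open>q\<close> of the two other coefficients
  is the same for all \<open>k\<close>. A section is then determined up to torus conjugation by \<open>q\<close>, since the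
  coefficients of the generators with a given product can be adjusted one after the other by a
  diagonal matrix.

  Everything else is read off from \<open>q\<close>. The square of the lift of $s_k$ is the class of the diagonal
  matrix with \<open>q\<close> at $k - 1$ and $k$ and with $1$ elsewhere, so the lift has twice the order of \<open>q\<close>. The
  section is homomorphic for $q = 1$, which is also the optimal case, because no lift has order $1$ and
  all lifts in a section have the same order. For every realization the Tits section has $q = -1$,
  and in the given coordinates $q = -a_{1,1} a_{1,2}^2$.
\<close>

section \<open>Roots of unity in an algebraically closed field\<close>

lemma infinite_UNIV_alg_closed: "infinite (UNIV :: 'a::alg_closed_field set)"
proof
  assume fin: "finite (UNIV :: 'a set)"
  define p where "p = (\<Prod>a\<in>(UNIV::'a set). [:- a, 1:])"
  have "Polynomial.degree p = card (UNIV :: 'a set)"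
    unfolding p_def by (subst degree_prod_eq_sum_degree) auto
  moreover have "card (UNIV :: 'a set) > 0"
    using fin by (simp add: card_gt_0_iff)
  ultimately have "Polynomial.degree (p + 1) > 0"
    by (simp add: degree_add_eq_left)
  then obtain x where "poly (p + 1) x = 0"
    using alg_closed_imp_poly_has_root by blast
  moreover have "poly p x = 0"
    using fin by (auto simp: p_def poly_prod)
  ultimately show False by simp
qed

lemma exists_distinct_units:
  obtains d :: "nat \<Rightarrow> 'a::alg_closed_field" where "inj d" "\<And>i. d i \<noteq> 0"
proof -
  have "infinite (UNIV - {0::'a})"
    using infinite_UNIV_alg_closed by simp
  then obtain d :: "nat \<Rightarrow> 'a" where "inj d" "range d \<subseteq> UNIV - {0}"
    using infinite_countable_subset by blast
  then show ?thesis by (intro that) auto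
qed

lemma primitive_root_power_eq_1_iff:
  assumes "primitive_root_of_unity m z"
  shows "z ^ k = 1 \<longleftrightarrow> m dvd k"
proof
  assume "z ^ k = 1"
  moreover have "z ^ k = z ^ (k mod m)"
    using assms unfolding primitive_root_of_unity_def
    by (metis div_mult_mod_eq mult.commute mult.left_neutral power_add power_mult power_one)
  moreover have "k mod m < m"
    using assms by (simp add: primitive_root_of_unity_def)
  ultimately have "k mod m = 0"
    using assms unfolding primitive_root_of_unity_def by (metis neq0_conv)
  then show "m dvd k" by auto
next
  assume "m dvd k"
  then show "z ^ k = 1"
    using assms by (auto simp: primitive_root_of_unity_def power_mult)
qed

text \<open>
  Induction on \<open>m\<close>, splitting off a prime factor \<open>p\<close>. If \<open>z\<close> is a primitive \<open>k\<close>-th root of unity,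
  then a \<open>p\<close>-th root \<open>y\<close> of \<open>z\<close> has order \<open>p k\<close> unless $y^k = 1$. The latter can only happen if \<open>p\<close> does
  not divide \<open>k\<close>, and then it is repaired by multiplying \<open>y\<close> with a nontrivial \<open>p\<close>-th root of unity.
\<close>

lemma exists_primitive_root:
  assumes "m > 0" "of_nat m \<noteq> (0::'a::alg_closed_field)"
  shows "\<exists>z::'a. primitive_root_of_unity m z"
  using assms
proof (induction m rule: less_induct)
  case (less m)
  show ?case
  proof (cases "m = 1")
    case True
    then show ?thesis
      by (intro exI[of _ 1]) (auto simp: primitive_root_of_unity_def)
  next
    case False
    then obtain p where p: "Factorial_Ring.prime p" "p dvd m"
      using prime_factor_nat by blast
    then obtain k where m: "m = p * k" by auto
    have "p > 1" using p(1) prime_gt_1_nat by blast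
    have p0: "of_nat p \<noteq> (0::'a)" and k0: "of_nat k \<noteq> (0::'a)"
      using less.prems m by auto
    have "k > 0" "k < m" using m less.prems \<open>p > 1\<close> by auto
    then obtain z :: 'a where z: "primitive_root_of_unity k z"
      using less.IH k0 by blast
    note zpow = primitive_root_power_eq_1_iff[OF z]
    obtain y0 where y0: "y0 ^ p = z"
      using nth_root_exists[of p z] \<open>p > 1\<close> by auto
    have "\<exists>y. y ^ p = z \<and> y ^ k \<noteq> 1"
    proof (cases "y0 ^ k = 1")
      case True
      have "\<not> p dvd k"
      proof
        assume "p dvd k"
        then obtain j where j: "k = p * j" by auto
        then have "z ^ j = 1" using True y0 by (simp add: power_mult)
        then have "k dvd j" by (simp add: zpow)
        then show False using j \<open>k > 0\<close> \<open>p > 1\<close> by (auto dest: dvd_imp_le)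
      qed
      \<comment> \<open>A root of $1 + X + \dots + X^{p-1}$ is a \<open>p\<close>-th root of unity; it is not $1$, as $p \ne 0$ in the field.\<close>
      obtain x :: 'a where x: "(\<Sum>i\<le>p - 1. 1 * x ^ i) = 0"
        using alg_closed[of "p - 1" "\<lambda>_. 1"] \<open>p > 1\<close> by auto
      have "{..p - 1} = {..<p}" using \<open>p > 1\<close> by auto
      then have sum0: "(\<Sum>i<p. x ^ i) = 0" using x by simp
      then have "x ^ p = 1"
        using one_diff_power_eq[of x p] by simp
      have "x \<noteq> 1" using sum0 p0 by auto
      have "coprime k p"
        using \<open>\<not> p dvd k\<close> p(1) prime_imp_coprime coprime_commute by blast
      then obtain u v where uv: "k * u = p * v + 1"
        using bezout_nat[of k p] \<open>k > 0\<close> by auto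
      have "x ^ k \<noteq> 1"
      proof
        assume "x ^ k = 1"
        then have "x ^ (k * u) = 1" by (simp add: power_mult)
        then show False
          using uv \<open>x ^ p = 1\<close> \<open>x \<noteq> 1\<close> by (simp add: power_add power_mult)
      qed
      then show ?thesis
        using True y0 \<open>x ^ p = 1\<close>
        by (intro exI[of _ "y0 * x"]) (simp add: power_mult_distrib)
    qed (use y0 in blast)
    then obtain y where y: "y ^ p = z" "y ^ k \<noteq> 1" by blast
    have dvd: "m dvd j" if "y ^ j = 1" for j
    proof -
      have "z ^ j = 1"
        using that y(1) by (metis mult.commute power_mult power_one)
      then obtain i where i: "j = k * i" using zpow by auto
      have "(y ^ k) ^ p = 1"
        using y(1) zpow by (metis dvd_refl mult.commute power_mult)
      have "p dvd i"
      proof (rule ccontr)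
        assume "\<not> p dvd i"
        then have "coprime i p" "i \<noteq> 0"
          using p(1) prime_imp_coprime coprime_commute by (blast, metis dvd_0_right)
        then obtain u v where uv: "i * u = p * v + 1"
          using bezout_nat[of i p] by auto
        have "(y ^ k) ^ (i * u) = 1"
          using that i by (simp add: power_mult)
        then show False
          using uv \<open>(y ^ k) ^ p = 1\<close> y(2) by (simp add: power_add power_mult)
      qed
      then show ?thesis using i m by (simp add: mult.commute)
    qed
    have "y ^ m = 1"
      using y(1) zpow m by (metis dvd_refl power_mult)
    moreover have "y ^ j \<noteq> 1" if "0 < j" "j < m" for j
      using dvd[of j] nat_dvd_not_less[OF that] by blast
    ultimately have "primitive_root_of_unity m y"
      using less.prems(1) by (simp add: primitive_root_of_unity_def)
    then show ?thesis by blast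
  qed
qed

section \<open>Inversions\<close>

definition later_smaller :: "nat \<Rightarrow> (nat \<Rightarrow> nat) \<Rightarrow> nat \<Rightarrow> nat" where
  "later_smaller n w j = card {l \<in> {j<..n}. w l < w j}"

definition inversions :: "nat \<Rightarrow> (nat \<Rightarrow> nat) \<Rightarrow> nat" where
  "inversions n w = (\<Sum>j\<le>n. later_smaller n w j)"

definition word_perm :: "nat list \<Rightarrow> nat \<Rightarrow> nat" where
  "word_perm ks = foldr (\<lambda>k f. transpose (k - 1) k \<circ> f) ks id"

lemma word_perm_simps [simp]:
  "word_perm [] = id"
  "word_perm (k # ks) = transpose (k - 1) k \<circ> word_perm ks"
  by (simp_all add: word_perm_def)

lemma adjacent_transpose_permutes:
  fixes k n :: nat
  shows "k \<in> {1..n} \<Longrightarrow> transpose (k - 1) k permutes {..n}"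
  by (intro permutes_swap_id) auto

lemma word_perm_permutes:
  "set ks \<subseteq> {1..n} \<Longrightarrow> word_perm ks permutes {..n}"
  by (induction ks) (auto intro!: permutes_compose adjacent_transpose_permutes simp del: One_nat_def)

lemma later_smaller_id [simp]: "later_smaller n id j = 0"
  by (auto simp: later_smaller_def card_eq_0_iff)

text \<open>
  Swapping the values $k - 1$ and \<open>k\<close> affects only comparisons between these two values. As $k - 1$ stands
  before \<open>k\<close>, the swap creates one inversion, and it starts at the position of $k - 1$.
\<close>

lemma later_smaller_ascent:
  assumes w: "inj w" and k: "k \<ge> 1"
    and pr: "w p = k - 1" "w r = k" "p < r" "r \<le> n"
  shows "later_smaller n (transpose (k - 1) k \<circ> w) j
           = later_smaller n w j + (if w j = k - 1 then 1 else 0)"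
proof -
  let ?s = "transpose (k - 1) k"
  have s: "transpose (k - Suc 0) k x = (if x = k - 1 then k else if x = k then k - 1 else x)" for x
    by (auto simp: transpose_def)
  have wp: "w l = k - 1 \<longleftrightarrow> l = p" and wr: "w l = k \<longleftrightarrow> l = r" for l
    using w pr by (metis injD)+
  show ?thesis
  proof (cases "w j = k - 1")
    case True
    then have "j = p" unfolding wp .
    have *: "?s (w l) < k \<longleftrightarrow> w l < k - 1 \<or> w l = k" for l
      using k by (auto simp: s)
    have "{l \<in> {j<..n}. (?s \<circ> w) l < (?s \<circ> w) j} = insert r {l \<in> {j<..n}. w l < w j}"
      using True pr k \<open>j = p\<close> by (auto simp: * s wr[symmetric])
    moreover have "r \<notin> {l \<in> {j<..n}. w l < w j}"
      using True pr by auto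
    ultimately show ?thesis
      using True by (simp add: later_smaller_def)
  next
    case False
    have "(?s \<circ> w) l < (?s \<circ> w) j \<longleftrightarrow> w l < w j" if "j < l" for l
    proof (cases "w j = k")
      case True
      then have "w l \<noteq> k - 1" "w l \<noteq> k" using that pr wp wr by auto
      then show ?thesis using True k by (auto simp: s)
    next
      case False
      then show ?thesis using \<open>w j \<noteq> k - 1\<close> k by (auto simp: s)
    qed
    then have "{l \<in> {j<..n}. (?s \<circ> w) l < (?s \<circ> w) j} = {l \<in> {j<..n}. w l < w j}"
      by auto
    then show ?thesis using False by (simp add: later_smaller_def)
  qed
qed

lemma inversions_ascent:
  assumes "inj w" "k \<ge> 1" "w p = k - 1" "w r = k" "p < r" "r \<le> n"
  shows "inversions n (transpose (k - 1) k \<circ> w) = Suc (inversions n w)"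
proof -
  have wp: "w l = k - 1 \<longleftrightarrow> l = p" for l
    using assms(1,3) by (metis injD)
  show ?thesis
    using assms(5,6)
    unfolding inversions_def later_smaller_ascent[OF assms] wp
    by (simp add: sum.distrib)
qed

lemma inversions_descent:
  assumes "inj w" "k \<ge> 1" "w p = k - 1" "w r = k" "r < p" "p \<le> n"
  shows "inversions n w = Suc (inversions n (transpose (k - 1) k \<circ> w))"
proof -
  let ?w = "transpose (k - 1) k \<circ> w"
  have "transpose (k - 1) k \<circ> ?w = w"
    by (simp add: fun_eq_iff)
  moreover have "inversions n (transpose (k - 1) k \<circ> ?w) = Suc (inversions n ?w)"
    using assms by (intro inversions_ascent[where p = r and r = p]) (auto intro!: inj_compose)
  ultimately show ?thesis by simp
qed

lemma adjacent_positions: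
  fixes w :: "nat \<Rightarrow> nat"
  assumes "w permutes {..n}" "k \<in> {1..n}"
  obtains p r where "w p = k - 1" "w r = k" "p \<le> n" "r \<le> n" "p \<noteq> r"
proof -
  have "k - 1 \<in> w ` {..n}" "k \<in> w ` {..n}"
    using assms(2) unfolding permutes_image[OF assms(1)] by auto
  then obtain p r where "w p = k - 1" "w r = k" "p \<le> n" "r \<le> n" by auto
  moreover have "p \<noteq> r" using calculation assms(2) by auto
  ultimately show ?thesis using that by blast
qed

lemma inversions_step:
  assumes "w permutes {..n}" "k \<in> {1..n}"
  shows "inversions n (transpose (k - 1) k \<circ> w) \<le> Suc (inversions n w)"
proof -
  obtain p r where pr: "w p = k - 1" "w r = k" "p \<le> n" "r \<le> n" "p \<noteq> r"
    using adjacent_positions[OF assms] .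
  have "inj w" "k \<ge> 1" using assms by (auto simp: permutes_inj)
  then show ?thesis
    using inversions_ascent[of w k p r n] inversions_descent[of w k p r n] pr
    by (cases "p < r") auto
qed

lemma inversions_word_le:
  "set ks \<subseteq> {1..n} \<Longrightarrow> inversions n (word_perm ks) \<le> length ks"
proof (induction ks)
  case (Cons k ks)
  then have "inversions n (word_perm ks) \<le> length ks" by simp
  moreover have "inversions n (word_perm (k # ks)) \<le> Suc (inversions n (word_perm ks))"
    using Cons.prems by (auto intro!: inversions_step word_perm_permutes simp del: One_nat_def)
  ultimately show ?case by (simp only: word_perm_simps list.size)
qed (simp add: inversions_def)

text \<open>
  The inverse permutation is increasing.
\<close>

lemma permutes_without_descent:
  fixes w :: "nat \<Rightarrow> nat"
  assumes w: "w permutes {..n}"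
    and asc: "\<And>k p r. k \<in> {1..n} \<Longrightarrow> w p = k - 1 \<Longrightarrow> w r = k \<Longrightarrow> p < r"
  shows "w = id"
proof -
  have "k \<le> n \<Longrightarrow> k \<le> inv_into UNIV w k" for k
  proof (induction k)
    case (Suc k)
    have "inv_into UNIV w k < inv_into UNIV w (Suc k)"
      using Suc.prems asc[of "Suc k"] permutes_inverses[OF w] by simp
    then show ?case using Suc by simp
  qed simp
  then have "inv_into UNIV w = id"
    using permutes_natset_ge[OF permutes_inv[OF w]] by auto
  then show "w = id"
    using permutes_inv_inv[OF w] by simp
qed

text \<open>
  Bubble sort: removing descents one by one ends at the identity after as many steps as there are
  inversions.
\<close>

lemma exists_word_of_inversions_length:
  assumes "w permutes {..n}"
  shows "\<exists>ks. set ks \<subseteq> {1..n} \<and> word_perm ks = w \<and> length ks = inversions n w"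
  using assms
proof (induction "inversions n w" arbitrary: w rule: less_induct)
  case less
  show ?case
  proof (cases "w = id")
    case True
    then show ?thesis by (intro exI[of _ "[]"]) (simp add: inversions_def)
  next
    case False
    then obtain k p r where k: "k \<in> {1..n}" and pr: "w p = k - 1" "w r = k" "\<not> p < r"
      using permutes_without_descent[OF less.prems] by blast
    have "r \<noteq> p" using pr(1,2) k by (intro notI) (simp, arith)
    then have "r < p" using pr(3) by simp
    moreover have "p \<le> n"
      using pr(1) k permutes_in_image[OF less.prems, of p] by auto
    ultimately have inv: "inversions n w = Suc (inversions n (transpose (k - 1) k \<circ> w))"
      using pr k permutes_inj[OF less.prems] by (intro inversions_descent) auto
    have "transpose (k - 1) k \<circ> w permutes {..n}"
      using less.prems k by (intro permutes_compose adjacent_transpose_permutes)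
    then obtain ks where ks: "set ks \<subseteq> {1..n}" "word_perm ks = transpose (k - 1) k \<circ> w"
        "length ks = inversions n (transpose (k - 1) k \<circ> w)"
      using less.hyps inv by (metis lessI)
    then show ?thesis
      using k inv by (intro exI[of _ "k # ks"]) (auto simp: fun_eq_iff)
  qed
qed

section \<open>The projective linear group and its monomial elements\<close>

lemma smult_mat_assoc: "a \<cdot>\<^sub>m (b \<cdot>\<^sub>m A) = (a * b) \<cdot>\<^sub>m (A :: 'a::field mat)"
  by (intro eq_matI) (auto simp: mult.assoc)

lemma mult_mat_entry:
  assumes "A \<in> carrier_mat d d" "B \<in> carrier_mat d d" "i < d" "j < d"
  shows "(A * B) $$ (i, j) = (\<Sum>k<d. A $$ (i, k) * B $$ (k, j))"
  using assms by (auto simp: scalar_prod_def lessThan_atLeast0)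

lemma GL_simps:
  "carrier (GL d) = Units (ring_mat TYPE('a::field) d ())"
  "mult (GL d :: 'a mat monoid) = (*)"
  "one (GL d :: 'a mat monoid) = 1\<^sub>m d"
  by (simp_all add: GL_def units_of_def ring_mat_simps)

lemma group_GL: "group (GL d :: 'a::field mat monoid)"
proof -
  interpret ring "ring_mat TYPE('a) d ()" by (rule ring_mat)
  show ?thesis unfolding GL_def by (rule units_group)
qed

lemma GL_carrier_mat: "A \<in> carrier (GL d) \<Longrightarrow> A \<in> carrier_mat d d"
  by (auto simp: GL_simps Units_def ring_mat_simps)

lemma GL_intro:
  assumes "A \<in> carrier_mat d d" "B \<in> carrier_mat d d" "A * B = 1\<^sub>m d" "B * A = 1\<^sub>m d"
  shows "A \<in> carrier (GL d)"
  using assms by (auto simp: GL_simps Units_def ring_mat_simps)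

text \<open>
  Used to find, for every column of a matrix that normalizes the torus, the row of its nonzero entry.
\<close>

lemma GL_column_nonzero:
  assumes "A \<in> carrier (GL d)" "j < d"
  obtains i where "i < d" "A $$ (i, j) \<noteq> (0::'a::field)"
proof -
  have A: "A \<in> carrier_mat d d" using assms by (simp add: GL_carrier_mat)
  obtain B where B: "B \<in> carrier_mat d d" "B * A = 1\<^sub>m d"
    using assms by (auto simp: GL_simps Units_def ring_mat_simps)
  have "(\<Sum>k<d. B $$ (j, k) * A $$ (k, j)) = 1"
    using mult_mat_entry[OF B(1) A assms(2) assms(2)] B(2) assms(2) by simp
  then obtain k where "k < d" "B $$ (j, k) * A $$ (k, j) \<noteq> 0"
    by (metis (no_types, lifting) lessThan_iff sum.neutral zero_neq_one)
  then show ?thesis using that by auto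
qed

lemma scalar_in_GL: "c \<noteq> 0 \<Longrightarrow> c \<cdot>\<^sub>m 1\<^sub>m d \<in> carrier (GL d :: 'a::field mat monoid)"
  by (rule GL_intro[where B = "inverse c \<cdot>\<^sub>m 1\<^sub>m d"])
    (auto simp: smult_mat_assoc simp flip: mult_smult_assoc_mat)

lemma scalars_coset:
  assumes "A \<in> carrier_mat d d"
  shows "scalars d #>\<^bsub>GL d\<^esub> A = {c \<cdot>\<^sub>m A | c. c \<noteq> (0::'a::field)}"
proof -
  have "(c \<cdot>\<^sub>m 1\<^sub>m d) * A = c \<cdot>\<^sub>m A" for c
    using assms by (simp add: mult_smult_assoc_mat[OF one_carrier_mat])
  then show ?thesis
    by (auto simp: r_coset_def scalars_def GL_simps)
qed

lemma normal_scalars: "scalars d \<lhd> (GL d :: 'a::field mat monoid)"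
proof -
  interpret group "GL d :: 'a mat monoid" by (rule group_GL)
  have left: "(c \<cdot>\<^sub>m 1\<^sub>m d) * A = c \<cdot>\<^sub>m A"
    and right: "A * (c \<cdot>\<^sub>m 1\<^sub>m d) = c \<cdot>\<^sub>m A" if "A \<in> carrier_mat d d" for c and A :: "'a mat"
    using that by (simp_all add: mult_smult_assoc_mat[OF one_carrier_mat]
        mult_smult_distrib[OF _ one_carrier_mat])
  have sub: "subgroup (scalars d) (GL d :: 'a mat monoid)"
  proof (rule subgroupI)
    show "scalars d \<subseteq> carrier (GL d :: 'a mat monoid)"
      by (auto simp: scalars_def scalar_in_GL)
    show "(scalars d :: 'a mat set) \<noteq> {}"
      by (auto simp: scalars_def intro: exI[of _ 1])
  next
    fix A assume "A \<in> (scalars d :: 'a mat set)"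
    then obtain c where c: "A = c \<cdot>\<^sub>m 1\<^sub>m d" "c \<noteq> 0" by (auto simp: scalars_def)
    have "inv\<^bsub>GL d\<^esub> A = inverse c \<cdot>\<^sub>m 1\<^sub>m d"
      using c by (intro inv_equality) (auto simp: GL_simps(2,3) scalar_in_GL left smult_mat_assoc)
    then show "inv\<^bsub>GL d\<^esub> A \<in> scalars d"
      using c by (auto simp: scalars_def)
  next
    fix A B assume "A \<in> (scalars d :: 'a mat set)" "B \<in> (scalars d :: 'a mat set)"
    then obtain a b where "A = a \<cdot>\<^sub>m 1\<^sub>m d" "a \<noteq> 0" "B = b \<cdot>\<^sub>m 1\<^sub>m d" "b \<noteq> 0"
      by (auto simp: scalars_def)
    then have "A * B = (a * b) \<cdot>\<^sub>m 1\<^sub>m d" "a * b \<noteq> 0"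
      by (auto simp: left smult_mat_assoc)
    then show "A \<otimes>\<^bsub>GL d\<^esub> B \<in> scalars d"
      unfolding GL_simps scalars_def by blast
  qed
  show ?thesis
  proof (rule normalI[OF sub], rule ballI)
    fix A assume "A \<in> carrier (GL d :: 'a mat monoid)"
    then have "A \<in> carrier_mat d d" by (rule GL_carrier_mat)
    then show "scalars d #>\<^bsub>GL d\<^esub> A = A <#\<^bsub>GL d\<^esub> scalars d"
      by (auto simp: r_coset_def l_coset_def scalars_def GL_simps(2) left right)
  qed
qed

text \<open>
  The coefficients are attached to columns, not to rows, so that the product formula below does not
  involve inverse permutations.
\<close>

definition monomial_mat :: "nat \<Rightarrow> (nat \<Rightarrow> nat) \<Rightarrow> (nat \<Rightarrow> 'a::field) \<Rightarrow> 'a mat" where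
  "monomial_mat n w e = Matrix.mat (n + 1) (n + 1) (\<lambda>(i, j). if i = w j then e j else 0)"

lemma monomial_mat_carrier [simp]:
  "monomial_mat n w e \<in> carrier_mat (n + 1) (n + 1)"
  "monomial_mat n w e \<in> carrier_mat (Suc n) (Suc n)"
  by (simp_all add: monomial_mat_def)

lemma monomial_mat_entry:
  "i \<le> n \<Longrightarrow> j \<le> n \<Longrightarrow> monomial_mat n w e $$ (i, j) = (if i = w j then e j else 0)"
  by (simp add: monomial_mat_def)

lemma monomial_mat_mult:
  assumes "v permutes {..n}"
  shows "monomial_mat n w e * monomial_mat n v f = monomial_mat n (w \<circ> v) (\<lambda>j. e (v j) * f j)"
proof (rule eq_matI)
  fix i j assume "i < dim_row (monomial_mat n (w \<circ> v) (\<lambda>j. e (v j) * f j))"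
    "j < dim_col (monomial_mat n (w \<circ> v) (\<lambda>j. e (v j) * f j))"
  then have ij: "i \<le> n" "j \<le> n" by (auto simp: monomial_mat_def)
  have vj: "v j \<le> n" using permutes_in_image[OF assms, of j] ij by auto
  have "(monomial_mat n w e * monomial_mat n v f) $$ (i, j)
      = (\<Sum>k<n + 1. monomial_mat n w e $$ (i, k) * monomial_mat n v f $$ (k, j))"
    using ij by (intro mult_mat_entry) auto
  also have "\<dots> = (\<Sum>k<n + 1. if k = v j then (if i = w k then e k else 0) * f j else 0)"
    using ij by (intro sum.cong) (auto simp: monomial_mat_entry)
  also have "\<dots> = monomial_mat n (w \<circ> v) (\<lambda>j. e (v j) * f j) $$ (i, j)"
    using ij vj by (simp add: monomial_mat_entry)
  finally show "(monomial_mat n w e * monomial_mat n v f) $$ (i, j)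
    = monomial_mat n (w \<circ> v) (\<lambda>j. e (v j) * f j) $$ (i, j)" .
qed (auto simp: monomial_mat_def)

lemma monomial_mat_cong: "(\<And>j. j \<le> n \<Longrightarrow> e j = f j) \<Longrightarrow> monomial_mat n w e = monomial_mat n w f"
  by (intro eq_matI) (auto simp: monomial_mat_def)

lemma monomial_mat_id_1: "monomial_mat n id (\<lambda>_. 1) = 1\<^sub>m (n + 1)"
  by (intro eq_matI) (auto simp: monomial_mat_def)

lemma monomial_mat_in_GL:
  assumes w: "w permutes {..n}" and e: "e \<in> units_upto n"
  shows "monomial_mat n w e \<in> carrier (GL (n + 1))"
proof (rule GL_intro)
  let ?v = "inv_into UNIV w" and ?f = "\<lambda>j. inverse (e (inv_into UNIV w j))"
  have v: "?v permutes {..n}" using w by (rule permutes_inv)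
  have vn: "?v j \<le> n" if "j \<le> n" for j using permutes_in_image[OF v, of j] that by auto
  show "monomial_mat n w e * monomial_mat n ?v ?f = 1\<^sub>m (n + 1)"
    unfolding monomial_mat_mult[OF v] monomial_mat_id_1[symmetric] permutes_inv_o[OF w]
    using e vn by (intro monomial_mat_cong) (auto simp: units_upto_def)
  show "monomial_mat n ?v ?f * monomial_mat n w e = 1\<^sub>m (n + 1)"
    unfolding monomial_mat_mult[OF w] monomial_mat_id_1[symmetric] permutes_inv_o[OF w]
    using e by (intro monomial_mat_cong) (auto simp: units_upto_def permutes_inverses[OF w])
qed auto

lemma monomial_mat_smult_eq_iff:
  assumes w: "w permutes {..n}" and v: "v permutes {..n}" and e: "e \<in> units_upto n"
    and "c \<noteq> (0::'a::field)"
  shows "monomial_mat n v f = c \<cdot>\<^sub>m monomial_mat n w e \<longleftrightarrow> w = v \<and> (\<forall>j\<le>n. f j = c * e j)"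
proof
  assume eq: "monomial_mat n v f = c \<cdot>\<^sub>m monomial_mat n w e"
  have wn: "w j \<le> n" if "j \<le> n" for j using permutes_in_image[OF w, of j] that by auto
  have entry: "(if i = v j then f j else 0) = (if i = w j then c * e j else 0)"
    if "i \<le> n" "j \<le> n" for i j
    using arg_cong[OF eq, of "\<lambda>A. A $$ (i, j)"] that
    by (simp add: monomial_mat_def split: if_splits)
  have j: "w j = v j \<and> f j = c * e j" if "j \<le> n" for j
    using entry[OF wn[OF that] that] e that \<open>c \<noteq> 0\<close> by (auto simp: units_upto_def split: if_splits)
  moreover have "w j = v j" if "\<not> j \<le> n" for j
    using that permutes_not_in[OF w, of j] permutes_not_in[OF v, of j] by auto
  ultimately show "w = v \<and> (\<forall>j\<le>n. f j = c * e j)" by blast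
next
  assume "w = v \<and> (\<forall>j\<le>n. f j = c * e j)"
  then show "monomial_mat n v f = c \<cdot>\<^sub>m monomial_mat n w e"
    by (intro eq_matI) (auto simp: monomial_mat_def)
qed

locale adjoint_A =
  fixes n :: nat and G :: "'g monoid" (structure) and \<phi> :: "'a::alg_closed_field mat set \<Rightarrow> 'g"
  assumes adjoint: "adjoint_type_A n G \<phi>"
begin

sublocale group G
  using adjoint by (simp add: adjoint_type_A_def)

definition proj_elt :: "'a mat \<Rightarrow> 'g" where
  "proj_elt A = \<phi> (proj_class (n + 1) A)"

definition monomial :: "(nat \<Rightarrow> nat) \<Rightarrow> (nat \<Rightarrow> 'a) \<Rightarrow> 'g" where
  "monomial w e = proj_elt (monomial_mat n w e)"

lemma \<phi>_iso: "\<phi> \<in> iso (PGL (n + 1)) G"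
  using adjoint by (simp add: adjoint_type_A_def)

lemma PGL_carrier: "carrier (PGL (n + 1)) = proj_class (n + 1) ` carrier (GL (n + 1))"
  by (auto simp: PGL_def carrier_FactGroup proj_class_def)

lemma proj_elt_closed: "A \<in> carrier (GL (n + 1)) \<Longrightarrow> proj_elt A \<in> carrier G"
  using \<phi>_iso unfolding proj_elt_def iso_def hom_def PGL_carrier by auto

lemma proj_elt_surj: "g \<in> carrier G \<Longrightarrow> \<exists>A\<in>carrier (GL (n + 1)). g = proj_elt A"
  using \<phi>_iso unfolding proj_elt_def iso_def bij_betw_def PGL_carrier by auto

lemma proj_elt_mult:
  assumes "A \<in> carrier (GL (n + 1))" "B \<in> carrier (GL (n + 1))"
  shows "proj_elt (A * B) = proj_elt A \<otimes> proj_elt B"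
proof -
  have "proj_class (n + 1) (A * B)
      = proj_class (n + 1) A <#>\<^bsub>GL (n + 1)\<^esub> proj_class (n + 1) B"
    unfolding proj_class_def
    using normal.rcos_sum[OF normal_scalars assms] by (simp add: GL_simps(2))
  also have "\<dots> = proj_class (n + 1) A \<otimes>\<^bsub>PGL (n + 1)\<^esub> proj_class (n + 1) B"
    by (simp add: PGL_def)
  finally show ?thesis
    using \<phi>_iso assms unfolding proj_elt_def iso_def hom_def PGL_carrier by auto
qed

lemma proj_elt_eq_iff:
  assumes "A \<in> carrier (GL (n + 1))" "B \<in> carrier (GL (n + 1))"
  shows "proj_elt A = proj_elt B \<longleftrightarrow> (\<exists>c. c \<noteq> 0 \<and> B = c \<cdot>\<^sub>m A)"
proof -
  have AB: "A \<in> carrier_mat (n + 1) (n + 1)" "B \<in> carrier_mat (n + 1) (n + 1)"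
    using assms by (simp_all add: GL_carrier_mat)
  have one: "M = 1 \<cdot>\<^sub>m M" for M :: "'a mat" by (intro eq_matI) auto
  have "proj_elt A = proj_elt B \<longleftrightarrow> proj_class (n + 1) A = proj_class (n + 1) B"
    using \<phi>_iso assms unfolding proj_elt_def iso_def bij_betw_def PGL_carrier by (auto dest: inj_onD)
  also have "\<dots> \<longleftrightarrow> {c \<cdot>\<^sub>m A | c. c \<noteq> 0} = {c \<cdot>\<^sub>m B | c. c \<noteq> 0}"
    unfolding proj_class_def scalars_coset[OF AB(1)] scalars_coset[OF AB(2)] ..
  also have "\<dots> \<longleftrightarrow> (\<exists>c. c \<noteq> 0 \<and> B = c \<cdot>\<^sub>m A)"
  proof
    assume "{c \<cdot>\<^sub>m A | c. c \<noteq> 0} = {c \<cdot>\<^sub>m B | c. c \<noteq> 0}"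
    moreover have "B \<in> {c \<cdot>\<^sub>m B | c. c \<noteq> 0}" using one[of B] by force
    ultimately show "\<exists>c. c \<noteq> 0 \<and> B = c \<cdot>\<^sub>m A" by auto
  next
    assume "\<exists>c. c \<noteq> 0 \<and> B = c \<cdot>\<^sub>m A"
    then obtain c where c: "c \<noteq> 0" "B = c \<cdot>\<^sub>m A" by blast
    have "a \<cdot>\<^sub>m A = (a / c) \<cdot>\<^sub>m B" "a \<cdot>\<^sub>m B = (a * c) \<cdot>\<^sub>m A" for a
      using c by (simp_all add: smult_mat_assoc)
    then show "{c \<cdot>\<^sub>m A | c. c \<noteq> 0} = {c \<cdot>\<^sub>m B | c. c \<noteq> 0}"
      using c(1) by (auto, (metis divide_eq_0_iff | metis mult_eq_0_iff)+)
  qed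
  finally show ?thesis .
qed

lemma proj_elt_one: "proj_elt (1\<^sub>m (n + 1)) = \<one>"
proof -
  have I: "1\<^sub>m (n + 1) \<in> carrier (GL (n + 1))"
    using group.is_monoid[OF group_GL, THEN monoid.one_closed, of "n + 1"] by (simp add: GL_simps(3))
  have "proj_elt (1\<^sub>m (n + 1)) \<otimes> proj_elt (1\<^sub>m (n + 1)) = proj_elt (1\<^sub>m (n + 1))"
    using proj_elt_mult[OF I I] by simp
  then show ?thesis
    using proj_elt_closed[OF I] by (simp add: l_cancel_one')
qed

lemma monomial_closed: "w permutes {..n} \<Longrightarrow> e \<in> units_upto n \<Longrightarrow> monomial w e \<in> carrier G"
  unfolding monomial_def by (intro proj_elt_closed monomial_mat_in_GL)

lemma monomial_mult:
  assumes "w permutes {..n}" "e \<in> units_upto n" "v permutes {..n}" "f \<in> units_upto n"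
  shows "monomial w e \<otimes> monomial v f = monomial (w \<circ> v) (\<lambda>j. e (v j) * f j)"
  unfolding monomial_def monomial_mat_mult[OF assms(3), symmetric]
  by (intro proj_elt_mult[symmetric] monomial_mat_in_GL assms)

lemma monomial_eq_iff:
  assumes "w permutes {..n}" "e \<in> units_upto n" "v permutes {..n}" "f \<in> units_upto n"
  shows "monomial w e = monomial v f \<longleftrightarrow> w = v \<and> (\<exists>c. c \<noteq> 0 \<and> (\<forall>j\<le>n. f j = c * e j))"
  unfolding monomial_def proj_elt_eq_iff[OF monomial_mat_in_GL[OF assms(1,2)] monomial_mat_in_GL[OF assms(3,4)]]
  using monomial_mat_smult_eq_iff[OF assms(1,3,2)] by auto

lemma monomial_cong: "(\<And>j. j \<le> n \<Longrightarrow> e j = f j) \<Longrightarrow> monomial w e = monomial w f"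
  unfolding monomial_def using monomial_mat_cong by metis

lemma monomial_one: "monomial id (\<lambda>_. 1) = \<one>"
  unfolding monomial_def monomial_mat_id_1 by (rule proj_elt_one)

lemma units_const_1 [simp]: "(\<lambda>_. 1) \<in> units_upto n"
  by (simp add: units_upto_def)

lemma units_upto_mult:
  assumes "v permutes {..n}" "e \<in> units_upto n" "f \<in> units_upto n"
  shows "(\<lambda>j. e (v j) * f j) \<in> units_upto n"
  using assms permutes_in_image[OF assms(1)] by (auto simp: units_upto_def)

lemma monomial_inv:
  assumes w: "w permutes {..n}" and e: "e \<in> units_upto n"
  shows "inv (monomial w e) = monomial (inv_into UNIV w) (\<lambda>j. inverse (e (inv_into UNIV w j)))"
proof (rule inv_equality)
  let ?v = "inv_into UNIV w" and ?f = "\<lambda>j. inverse (e (inv_into UNIV w j))"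
  have v: "?v permutes {..n}" using w by (rule permutes_inv)
  have f: "?f \<in> units_upto n"
    using e permutes_in_image[OF v] by (auto simp: units_upto_def)
  show "monomial ?v ?f \<otimes> monomial w e = \<one>"
    unfolding monomial_mult[OF v f w e] permutes_inv_o[OF w] monomial_one[symmetric]
    using e by (intro monomial_cong) (auto simp: units_upto_def permutes_inverses[OF w])
  show "monomial w e \<in> carrier G" "monomial ?v ?f \<in> carrier G"
    by (intro monomial_closed v w e f)+
qed

lemma tor_eq_monomial: "tor n \<phi> d = monomial id d"
proof -
  have "mat_diag (n + 1) d = monomial_mat n id d"
    by (intro eq_matI) (auto simp: mat_diag_def monomial_mat_def)
  then show ?thesis by (simp add: tor_def monomial_def proj_elt_def)
qed

lemma torus_eq: "torus n \<phi> = monomial id ` units_upto n"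
  by (auto simp: torus_def tor_eq_monomial)

lemma torus_subset: "torus n \<phi> \<subseteq> carrier G"
  by (auto simp: torus_eq monomial_closed)

lemma monomial_conj_torus:
  assumes w: "w permutes {..n}" and e: "e \<in> units_upto n" and t: "t \<in> units_upto n"
  shows "monomial id t \<otimes> monomial w e \<otimes> inv (monomial id t) = monomial w (\<lambda>j. t (w j) / t j * e j)"
proof -
  have t': "(\<lambda>j. inverse (t j)) \<in> units_upto n" using t by (auto simp: units_upto_def)
  have te: "(\<lambda>j. t (w j) * e j) \<in> units_upto n" by (intro units_upto_mult w e t)
  have "monomial id t \<otimes> monomial w e \<otimes> inv (monomial id t) = monomial w (\<lambda>j. t (w j) * e j * inverse (t j))"
    using monomial_mult[OF permutes_id t w e] monomial_mult[OF w te permutes_id t'] monomial_inv[OF permutes_id t]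
    by simp
  also have "\<dots> = monomial w (\<lambda>j. t (w j) / t j * e j)"
    by (intro monomial_cong) (simp add: field_simps)
  finally show ?thesis .
qed

lemma torus_conjugate:
  assumes w: "w permutes {..n}" and e: "e \<in> units_upto n" and d: "d \<in> units_upto n"
  shows "monomial w e \<otimes> monomial id d \<otimes> inv (monomial w e) = monomial id (\<lambda>j. d (inv_into UNIV w j))"
proof -
  let ?v = "inv_into UNIV w" and ?f = "\<lambda>j. inverse (e (inv_into UNIV w j))"
  have v: "?v permutes {..n}" using w by (rule permutes_inv)
  have vn: "?v j \<le> n" if "j \<le> n" for j using permutes_in_image[OF v, of j] that by auto
  have f: "?f \<in> units_upto n"
    using e vn by (auto simp: units_upto_def)
  have ed: "(\<lambda>j. e (id j) * d j) \<in> units_upto n" by (intro units_upto_mult permutes_id e d)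
  have "monomial w e \<otimes> monomial id d \<otimes> inv (monomial w e)
      = monomial (w \<circ> id \<circ> ?v) (\<lambda>j. (e (id (?v j)) * d (?v j)) * ?f j)"
    unfolding monomial_inv[OF w e] monomial_mult[OF w e permutes_id d]
    by (subst monomial_mult) (use ed v f w in auto)
  also have "\<dots> = monomial id (\<lambda>j. d (?v j))"
    using e vn by (simp add: permutes_inv_o[OF w], intro monomial_cong) (auto simp: units_upto_def)
  finally show ?thesis .
qed

lemma monomial_normalizes: 
  assumes w: "w permutes {..n}" and e: "e \<in> units_upto n"
  shows "monomial w e <# torus n \<phi> #> inv (monomial w e) = torus n \<phi>"
proof -
  have v: "inv_into UNIV w permutes {..n}" using w by (rule permutes_inv)
  have "(\<lambda>d j. d (inv_into UNIV w j)) ` units_upto n = (units_upto n :: (nat \<Rightarrow> 'a) set)"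
  proof (intro equalityI subsetI)
    fix d :: "nat \<Rightarrow> 'a" assume "d \<in> units_upto n"
    then have "(\<lambda>j. d (w j)) \<in> units_upto n"
      using permutes_in_image[OF w] by (auto simp: units_upto_def)
    then show "d \<in> (\<lambda>d j. d (inv_into UNIV w j)) ` units_upto n"
      by (rule rev_image_eqI) (simp add: permutes_inverses[OF w])
  qed (use permutes_in_image[OF v] in \<open>auto simp: units_upto_def\<close>)
  moreover have "monomial w e <# torus n \<phi> #> inv (monomial w e)
      = (\<lambda>d. monomial w e \<otimes> monomial id d \<otimes> inv (monomial w e)) ` units_upto n"
    by (auto simp: l_coset_def r_coset_def torus_eq)
  moreover have "\<dots> = monomial id ` (\<lambda>d j. d (inv_into UNIV w j)) ` units_upto n"
    by (auto simp: torus_conjugate[OF w e] image_image)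
  ultimately show ?thesis by (simp add: torus_eq)
qed

text \<open>
  Conjugate a diagonal matrix \<open>D\<close> with distinct entries. If \<open>A\<close> normalizes the torus, then $A D$ is
  $F A$ up to a scalar for some diagonal matrix \<open>F\<close>, so nonzero entries in one row of \<open>A\<close> belong to
  equal entries of \<open>D\<close>. Hence every row of \<open>A\<close> has at most one nonzero entry.
\<close>

lemma normalizing_imp_monomial:
  assumes g: "g \<in> carrier G" and norm: "g <# torus n \<phi> #> inv g = torus n \<phi>"
  shows "\<exists>w e. w permutes {..n} \<and> e \<in> units_upto n \<and> g = monomial w e"
proof -
  obtain A where A: "A \<in> carrier (GL (n + 1))" "g = proj_elt A"
    using proj_elt_surj[OF g] by blast
  have Amat: "A \<in> carrier_mat (n + 1) (n + 1)" using A by (simp add: GL_carrier_mat)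
  obtain d :: "nat \<Rightarrow> 'a" where d: "inj d" "\<And>i. d i \<noteq> 0"
    using exists_distinct_units by metis
  have du: "d \<in> units_upto n" using d by (simp add: units_upto_def)
  have "g \<otimes> monomial id d \<otimes> inv g \<in> g <# torus n \<phi> #> inv g"
    using du by (auto simp: l_coset_def r_coset_def torus_eq)
  then obtain f where f: "f \<in> units_upto n" "g \<otimes> monomial id d \<otimes> inv g = monomial id f"
    unfolding norm unfolding torus_eq by auto
  have cd: "monomial id d \<in> carrier G" "monomial id f \<in> carrier G"
    using monomial_closed permutes_id du f by blast+
  have "g \<otimes> monomial id d = monomial id f \<otimes> g"
    using f(2) g cd by (metis inv_solve_right m_closed)
  then have "proj_elt (A * monomial_mat n id d) = proj_elt (monomial_mat n id f * A)"
    unfolding monomial_def A(2) proj_elt_mult[OF A(1) monomial_mat_in_GL[OF permutes_id du]]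
      proj_elt_mult[OF monomial_mat_in_GL[OF permutes_id f(1)] A(1)] .
  moreover have "A * monomial_mat n id d \<in> carrier (GL (n + 1))" "monomial_mat n id f * A \<in> carrier (GL (n + 1))"
    using monoid.m_closed[OF group.is_monoid[OF group_GL]] A(1) monomial_mat_in_GL[OF permutes_id] du f(1)
    unfolding GL_simps(2) by blast+
  ultimately obtain c where c: "c \<noteq> 0" "monomial_mat n id f * A = c \<cdot>\<^sub>m (A * monomial_mat n id d)"
    using proj_elt_eq_iff by blast
  have left: "(monomial_mat n id f * A) $$ (i, j) = f i * A $$ (i, j)" if "i \<le> n" "j \<le> n" for i j
  proof -
    have "(monomial_mat n id f * A) $$ (i, j) = (\<Sum>k<n + 1. if k = i then f i * A $$ (i, j) else 0)"
      by (subst mult_mat_entry[OF monomial_mat_carrier(1) Amat], use that in simp, use that in simp,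
          rule sum.cong) (use that in \<open>auto simp: monomial_mat_entry\<close>)
    then show ?thesis using that by simp
  qed
  have right: "(A * monomial_mat n id d) $$ (i, j) = A $$ (i, j) * d j" if "i \<le> n" "j \<le> n" for i j
  proof -
    have "(A * monomial_mat n id d) $$ (i, j) = (\<Sum>k<n + 1. if k = j then A $$ (i, j) * d j else 0)"
      by (subst mult_mat_entry[OF Amat monomial_mat_carrier(1)], use that in simp, use that in simp,
          rule sum.cong) (use that in \<open>auto simp: monomial_mat_entry\<close>)
    then show ?thesis using that by simp
  qed
  have row_unique: "j = k" if "i \<le> n" "j \<le> n" "k \<le> n" "A $$ (i, j) \<noteq> 0" "A $$ (i, k) \<noteq> 0" for i j k
  proof -
    have "f i = c * d j" if "j \<le> n" "A $$ (i, j) \<noteq> 0" for j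
      using arg_cong[OF c(2), of "\<lambda>M. M $$ (i, j)"] left[OF \<open>i \<le> n\<close> that(1)] right[OF \<open>i \<le> n\<close> that(1)]
        that \<open>i \<le> n\<close> Amat by (auto simp: monomial_mat_def)
    then have "c * d j = c * d k" using that by metis
    then show ?thesis using c(1) d(1) by (simp add: inj_eq)
  qed
  have "\<forall>j\<in>{..n}. \<exists>i\<le>n. A $$ (i, j) \<noteq> 0"
    using GL_column_nonzero[OF A(1)] by (metis Suc_eq_plus1 atMost_iff le_imp_less_Suc less_Suc_eq_le)
  then obtain v where v: "\<And>j. j \<le> n \<Longrightarrow> v j \<le> n \<and> A $$ (v j, j) \<noteq> 0"
    by (metis atMost_iff)
  define w where "w j = (if j \<le> n then v j else j)" for j
  have w: "w j \<le> n" "A $$ (w j, j) \<noteq> 0" if "j \<le> n" for j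
    using v that by (auto simp: w_def)
  have "inj_on w {..n}"
    by (rule inj_onI) (metis atMost_iff row_unique w)
  then have wp: "w permutes {..n}"
    using w by (intro inj_imp_permutes) (auto simp: w_def)
  define e where "e j = A $$ (w j, j)" for j
  have eu: "e \<in> units_upto n" using w by (auto simp: e_def units_upto_def)
  have "A = monomial_mat n w e"
  proof (rule eq_matI)
    fix i j assume "i < dim_row (monomial_mat n w e)" "j < dim_col (monomial_mat n w e)"
    then have ij: "i \<le> n" "j \<le> n" by (auto simp: monomial_mat_def)
    obtain k where k: "k \<le> n" "i = w k"
      using permutes_image[OF wp] ij(1) by (metis atMost_iff imageE)
    show "A $$ (i, j) = monomial_mat n w e $$ (i, j)"
      using ij w k row_unique[of i j k] by (auto simp: monomial_mat_entry e_def)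
  qed (use Amat in \<open>auto simp: monomial_mat_def\<close>)
  then show ?thesis using wp eu A(2) by (auto simp: monomial_def)
qed

lemma norm_torus_iff:
  "g \<in> norm_torus n G \<phi> \<longleftrightarrow> (\<exists>w e. w permutes {..n} \<and> e \<in> units_upto n \<and> g = monomial w e)"
proof -
  have "g \<in> norm_torus n G \<phi> \<longleftrightarrow> g \<in> carrier G \<and> g <# torus n \<phi> #> inv g = torus n \<phi>"
    using torus_subset by (auto simp: norm_torus_def normalizer_def stabilizer_def)
  then show ?thesis using normalizing_imp_monomial monomial_normalizes monomial_closed by blast
qed

text \<open>
  The parametrizations of opposite root subgroups may be rescaled by factors \<open>c\<close> and \<open>b\<close>. The
  product that defines $\sigma$ is monomial only if its diagonal entry $1 + c b$ vanishes; this uses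
  $b \ne 0$, which holds because the parametrization is injective. So the rescaling does
  not change the product of the two coefficients.
\<close>

lemma sigma_eq_monomial:
  assumes real: "realization n G \<phi> u" and ij: "i \<le> n" "j \<le> n" "i \<noteq> j"
  shows "\<exists>f. f \<in> units_upto n \<and> f i * f j = - 1 \<and> (\<forall>r. r \<noteq> i \<longrightarrow> r \<noteq> j \<longrightarrow> f r = 1)
    \<and> sigma G u i j = monomial (transpose i j) f"
proof -
  have addrow_GL: "addrow_mat (n + 1) x k l \<in> carrier (GL (n + 1))"
    if "k \<le> n" "l \<le> n" "k \<noteq> l" for x :: 'a and k l
    using addrow_mat_Unit[of k "n + 1" l x "()"] that by (simp add: GL_simps(1))
  have u: "u k l x \<in> range (\<lambda>x. proj_elt (addrow_mat (n + 1) x k l))" "inj (u k l)"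
    "u k l (x + y) = u k l x \<otimes> u k l y"
    if "k \<le> n" "l \<le> n" "k \<noteq> l" for k l x y
  proof -
    have "bij_betw (u k l) UNIV (range (\<lambda>x. proj_elt (addrow_mat (n + 1) x k l)))"
      using real that by (simp add: realization_def root_subgroup_def proj_elt_def)
    then show "u k l x \<in> range (\<lambda>x. proj_elt (addrow_mat (n + 1) x k l))" "inj (u k l)"
      unfolding bij_betw_def by blast+
    show "u k l (x + y) = u k l x \<otimes> u k l y"
      using real that by (simp add: realization_def)
  qed
  obtain c where c: "u i j 1 = proj_elt (addrow_mat (n + 1) c i j)"
    using u(1)[OF ij, of 1] by auto
  obtain b where b: "u j i (- 1) = proj_elt (addrow_mat (n + 1) b j i)"
    using u(1)[OF ij(2,1), of "- 1"] ij by auto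
  have "b \<noteq> 0"
  proof
    assume "b = 0"
    then have "addrow_mat (n + 1) b j i = 1\<^sub>m (n + 1)"
      by (intro eq_matI) auto
    then have "u j i (- 1) = \<one>" by (simp only: b proj_elt_one)
    moreover have "u j i 0 = \<one>"
    proof -
      have "u j i 0 \<in> carrier G"
        using u(1)[OF ij(2,1), of 0] proj_elt_closed[OF addrow_GL[OF ij(2,1)]] ij by auto
      then show ?thesis using u(3)[OF ij(2,1), of 0 0] ij(3) by (simp add: l_cancel_one')
    qed
    ultimately have "u j i (- 1) = u j i 0" by simp
    then show False using u(2)[OF ij(2,1)] ij(3) by (auto dest: injD)
  qed
  define A where "A = addrow_mat (n + 1) c i j * (addrow_mat (n + 1) b j i * addrow_mat (n + 1) c i j)"
  have A: "A = addrow c i j (addrow b j i (addrow_mat (n + 1) c i j))"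
    unfolding A_def using ij
    by (subst (1 2) addrow_mat) (auto intro: le_imp_less_Suc)
  note GLm = addrow_GL[OF ij, of c] addrow_GL[OF ij(2,1) ij(3)[symmetric], of b]
  note GL_closed = monoid.m_closed[OF group.is_monoid[OF group_GL], unfolded GL_simps(2)]
  have AGL: "A \<in> carrier (GL (n + 1))"
    unfolding A_def by (intro GL_closed GLm)
  have sig: "sigma G u i j = proj_elt A"
    unfolding A_def sigma_def c b
    using GLm by (simp add: proj_elt_mult[OF GLm(1) GL_closed[OF GLm(2,1)]] proj_elt_mult[OF GLm(2,1)] proj_elt_closed m_assoc
        del: One_nat_def)
  have entries: "A $$ (r, s) = (if r = i then if s = i then 1 + c * b
          else if s = j then c * (1 + b * c) + c else 0
        else if r = j then if s = i then b else if s = j then 1 + b * c else 0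
        else if r = s then 1 else 0)" if "r \<le> n" "s \<le> n" for r s
    using that ij unfolding A by (auto simp: algebra_simps)
  have "sigma G u i j \<in> norm_torus n G \<phi>"
    using real ij by (auto simp: realization_def)
  then obtain w e where w: "w permutes {..n}" "e \<in> units_upto n" "proj_elt A = monomial w e"
    unfolding norm_torus_iff sig by blast
  then obtain a where a: "a \<noteq> 0" "monomial_mat n w e = a \<cdot>\<^sub>m A"
    unfolding monomial_def using proj_elt_eq_iff[OF AGL monomial_mat_in_GL] by blast
  have mono: "(if r = w s then e s else 0) = a * A $$ (r, s)" if "r \<le> n" "s \<le> n" for r s
    using arg_cong[OF a(2), of "\<lambda>M. M $$ (r, s)"] that GL_carrier_mat[OF AGL]
    by (simp add: monomial_mat_entry)
  have "w i = j"
    using mono[OF ij(2,1)] a \<open>b \<noteq> 0\<close> ij entries[OF ij(2,1)] by (auto split: if_splits)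
  then have "1 + c * b = 0"
    using mono[OF ij(1,1)] a ij entries[OF ij(1,1)] by (auto split: if_splits)
  then have bc: "b * c = - 1" by (simp add: mult.commute add_eq_0_iff)
  define f where "f = (\<lambda>_. 1)(i := b, j := c)"
  have "c \<noteq> 0" using bc by auto
  then have "f \<in> units_upto n" using \<open>b \<noteq> 0\<close> by (auto simp: f_def units_upto_def)
  moreover have "f i * f j = - 1" using bc ij by (simp add: f_def)
  moreover have "A = monomial_mat n (transpose i j) f"
  proof (rule eq_matI)
    fix r s assume "r < dim_row (monomial_mat n (transpose i j) f)" "s < dim_col (monomial_mat n (transpose i j) f)"
    then have rs: "r \<le> n" "s \<le> n" by (auto simp: monomial_mat_def)
    show "A $$ (r, s) = monomial_mat n (transpose i j) f $$ (r, s)"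
      using rs ij \<open>1 + c * b = 0\<close>
      by (auto simp: entries monomial_mat_entry f_def transpose_def mult.commute)
  qed (use GL_carrier_mat[OF AGL] in \<open>auto simp: monomial_mat_def\<close>)
  ultimately show ?thesis
    using sig by (intro exI[of _ f]) (auto simp: monomial_def f_def)
qed

end

context adjoint_A
begin

section \<open>The Weyl group and its reduced words\<close>

definition weyl_elt :: "(nat \<Rightarrow> nat) \<Rightarrow> 'g set" where
  "weyl_elt w = monomial w ` units_upto n"

lemma torus_coset_monomial:
  assumes w: "w permutes {..n}" and e: "e \<in> units_upto n"
  shows "torus n \<phi> #> monomial w e = weyl_elt w"
proof -
  have "monomial id t \<otimes> monomial w e \<in> weyl_elt w" if "t \<in> units_upto n" for t
    unfolding monomial_mult[OF permutes_id that w e] weyl_elt_def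
    using units_upto_mult[OF w that e] by simp
  moreover have "monomial w f \<in> (\<lambda>t. monomial id t \<otimes> monomial w e) ` units_upto n" if f: "f \<in> units_upto n" for f
  proof (rule image_eqI)
    let ?v = "inv_into UNIV w"
    let ?t = "\<lambda>j. f (?v j) / e (?v j)"
    show t: "?t \<in> units_upto n"
      using e f permutes_in_image[OF permutes_inv[OF w]] by (auto simp: units_upto_def)
    show "monomial w f = monomial id ?t \<otimes> monomial w e"
      unfolding monomial_mult[OF permutes_id t w e] id_comp
      using e by (intro monomial_cong) (auto simp: units_upto_def permutes_inverses[OF w])
  qed
  ultimately show ?thesis
    by (auto simp: r_coset_def torus_eq weyl_elt_def)
qed

lemma weyl_elt_id: "weyl_elt id = torus n \<phi>"
  by (simp add: weyl_elt_def torus_eq)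

lemma weyl_elt_inj: "w permutes {..n} \<Longrightarrow> v permutes {..n} \<Longrightarrow> weyl_elt w = weyl_elt v \<longleftrightarrow> w = v"
proof
  assume w: "w permutes {..n}" "v permutes {..n}" and "weyl_elt w = weyl_elt v"
  then have "monomial w (\<lambda>_. 1) \<in> weyl_elt v" by (auto simp: weyl_elt_def)
  then show "w = v" using w by (auto simp: weyl_elt_def monomial_eq_iff)
qed simp

lemma weyl_carrier: "carrier (weyl n G \<phi>) = weyl_elt ` {w. w permutes {..n}}"
proof -
  have "carrier (weyl n G \<phi>) = (\<lambda>g. torus n \<phi> #> g) ` norm_torus n G \<phi>"
    by (simp add: weyl_def carrier_FactGroup r_coset_def)
  also have "\<dots> = weyl_elt ` {w. w permutes {..n}}"
  proof (intro equalityI subsetI)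
    fix K assume "K \<in> weyl_elt ` {w. w permutes {..n}}"
    then obtain w where w: "w permutes {..n}" "K = weyl_elt w" by auto
    then have "K = torus n \<phi> #> monomial w (\<lambda>_. 1)" by (simp add: torus_coset_monomial)
    moreover have "monomial w (\<lambda>_. 1) \<in> norm_torus n G \<phi>"
      using w norm_torus_iff units_const_1 by blast
    ultimately show "K \<in> (\<lambda>g. torus n \<phi> #> g) ` norm_torus n G \<phi>" by blast
  qed (auto simp: norm_torus_iff torus_coset_monomial)
  finally show ?thesis .
qed

lemma weyl_mult:
  assumes w: "w permutes {..n}" and v: "v permutes {..n}"
  shows "weyl_elt w \<otimes>\<^bsub>weyl n G \<phi>\<^esub> weyl_elt v = weyl_elt (w \<circ> v)"
proof -
  have "weyl_elt w \<otimes>\<^bsub>weyl n G \<phi>\<^esub> weyl_elt v = (\<Union>e\<in>units_upto n. \<Union>f\<in>units_upto n. {monomial w e \<otimes> monomial v f})"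
    by (simp add: weyl_def set_mult_def weyl_elt_def)
  also have "\<dots> = weyl_elt (w \<circ> v)"
  proof (intro equalityI subsetI)
    fix g assume "g \<in> weyl_elt (w \<circ> v)"
    then obtain f where f: "f \<in> units_upto n" "g = monomial (w \<circ> v) f" by (auto simp: weyl_elt_def)
    then have "g = monomial w (\<lambda>_. 1) \<otimes> monomial v f" by (simp add: monomial_mult w v)
    then show "g \<in> (\<Union>e\<in>units_upto n. \<Union>f\<in>units_upto n. {monomial w e \<otimes> monomial v f})"
      using f units_const_1 by blast
  qed (auto simp: weyl_elt_def monomial_mult[OF w _ v] intro!: imageI units_upto_mult[OF v])
  finally show ?thesis .
qed

lemma weyl_one: "\<one>\<^bsub>weyl n G \<phi>\<^esub> = weyl_elt id"
  by (simp add: weyl_def weyl_elt_id)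

end

lemma transpose_adjacent:
  fixes k :: nat
  shows "transpose (k - 1) k r = (if r = k - 1 then k else if r = k then k - 1 else r)"
  by (auto simp: transpose_def)

locale realized_A = adjoint_A n G \<phi>
  for n and G (structure) and \<phi> :: "'a::alg_closed_field mat set \<Rightarrow> 'g" +
  fixes u :: "nat \<Rightarrow> nat \<Rightarrow> 'a \<Rightarrow> 'g"
  assumes rank: "n \<ge> 6" and realized: "realization n G \<phi> u"
begin

abbreviation s :: "nat \<Rightarrow> nat \<Rightarrow> nat" where
  "s k \<equiv> transpose (k - 1) k"

lemma s_permutes: "k \<in> {1..n} \<Longrightarrow> s k permutes {..n}"
  by (rule adjacent_transpose_permutes)

lemma simple_sigma_eq_monomial:
  assumes "k \<in> {1..n}"
  obtains f where "f \<in> units_upto n" "f (k - 1) * f k = - 1"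
    "\<And>r. r \<noteq> k - 1 \<Longrightarrow> r \<noteq> k \<Longrightarrow> f r = 1" "simple_sigma G u k = monomial (s k) f"
proof -
  have "k - 1 \<le> n" "k \<le> n" "k - 1 \<noteq> k" using assms by auto
  then show ?thesis
    using that sigma_eq_monomial[OF realized, of "k - 1" k] unfolding simple_sigma_def by blast
qed

lemma simple_refl_eq: 
  assumes "k \<in> {1..n}"
  shows "simple_refl n G \<phi> k = weyl_elt (s k)"
proof -
  obtain f where f: "f \<in> units_upto n" "simple_sigma G u k = monomial (s k) f"
    using simple_sigma_eq_monomial[OF assms] by metis
  have "k - 1 \<le> n" "k \<le> n" "k - 1 \<noteq> k" using assms by auto
  then have "simple_refl n G \<phi> k = torus n \<phi> #> simple_sigma G u k"
    using realized unfolding simple_refl_def simple_sigma_def realization_def by metis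
  then show ?thesis
    using f torus_coset_monomial[OF s_permutes[OF assms] f(1)] by simp
qed

lemma weyl_word_eq: "set ks \<subseteq> {1..n} \<Longrightarrow> weyl_word n G \<phi> ks = weyl_elt (word_perm ks)"
proof (induction ks)
  case (Cons k ks)
  then have k: "k \<in> {1..n}" and ks: "set ks \<subseteq> {1..n}" by auto
  have "weyl_word n G \<phi> (k # ks) = weyl_elt (s k) \<otimes>\<^bsub>weyl n G \<phi>\<^esub> weyl_elt (word_perm ks)"
    using Cons.IH[OF ks] simple_refl_eq[OF k] by (simp add: weyl_word_def)
  also have "\<dots> = weyl_elt (s k \<circ> word_perm ks)"
    by (rule weyl_mult[OF s_permutes[OF k] word_perm_permutes[OF ks]])
  finally show ?case by (simp only: word_perm_simps)
qed (simp add: weyl_word_def weyl_one)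

text \<open>
  The length of a Weyl group element is its number of inversions: a letter changes it by at most one,
  and some word attains it.
\<close>

lemma reduced_word_iff:
  "reduced_word n G \<phi> ks \<longleftrightarrow> set ks \<subseteq> {1..n} \<and> length ks = inversions n (word_perm ks)"
proof (cases "set ks \<subseteq> {1..n}")
  case True
  note ks = word_perm_permutes[OF True]
  have same: "weyl_word n G \<phi> ls = weyl_word n G \<phi> ks \<longleftrightarrow> word_perm ls = word_perm ks"
    if "set ls \<subseteq> {1..n}" for ls
    unfolding weyl_word_eq[OF that] weyl_word_eq[OF True]
    by (rule weyl_elt_inj[OF word_perm_permutes[OF that] ks])
  obtain ls where ls: "set ls \<subseteq> {1..n}" "word_perm ls = word_perm ks"
      "length ls = inversions n (word_perm ks)"
    using exists_word_of_inversions_length[OF ks] by blast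
  show ?thesis
  proof
    assume "reduced_word n G \<phi> ks"
    then have "length ks \<le> length ls"
      using ls same[OF ls(1)] by (auto simp: reduced_word_def)
    then show "set ks \<subseteq> {1..n} \<and> length ks = inversions n (word_perm ks)"
      using ls True inversions_word_le[OF True] by simp
  next
    assume len: "set ks \<subseteq> {1..n} \<and> length ks = inversions n (word_perm ks)"
    have "length ks \<le> length ls'"
      if "set ls' \<subseteq> {1..n}" "weyl_word n G \<phi> ls' = weyl_word n G \<phi> ks" for ls'
      using inversions_word_le[OF that(1)] same[OF that(1)] that(2) len by simp
    then show "reduced_word n G \<phi> ks"
      using True by (simp add: reduced_word_def)
  qed
qed (auto simp: reduced_word_def)

lemma reduced_Nil: "reduced_word n G \<phi> []"
  by (simp add: reduced_word_iff inversions_def)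

lemma reduced_Cons:
  assumes "reduced_word n G \<phi> ks" "k \<in> {1..n}"
    "word_perm ks p = k - 1" "word_perm ks r = k" "p < r" "r \<le> n"
  shows "reduced_word n G \<phi> (k # ks)"
proof -
  have "set ks \<subseteq> {1..n}" using assms(1) by (simp add: reduced_word_iff)
  then have "inj (word_perm ks)" using permutes_inj word_perm_permutes by blast
  then have "inversions n (s k \<circ> word_perm ks) = Suc (inversions n (word_perm ks))"
    using assms by (intro inversions_ascent[where p = p and r = r]) auto
  then show ?thesis
    using assms(1,2) by (simp add: reduced_word_iff)
qed

lemma reduced_ConsD:
  assumes red: "reduced_word n G \<phi> (k # ks)"
  obtains p r where "reduced_word n G \<phi> ks" "k \<in> {1..n}" "set ks \<subseteq> {1..n}"
    "word_perm ks p = k - 1" "word_perm ks r = k" "p < r" "r \<le> n"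
proof -
  have k: "k \<in> {1..n}" and ks: "set ks \<subseteq> {1..n}"
    and len: "Suc (length ks) = inversions n (s k \<circ> word_perm ks)"
    using red by (auto simp: reduced_word_iff)
  note w = word_perm_permutes[OF ks]
  have "inversions n (word_perm ks) = length ks"
    using len inversions_step[OF w k] inversions_word_le[OF ks] by simp
  moreover obtain p r where pr: "word_perm ks p = k - 1" "word_perm ks r = k" "p \<le> n" "r \<le> n" "p \<noteq> r"
    using adjacent_positions[OF w k] .
  moreover have "\<not> r < p"
    using inversions_descent[of "word_perm ks" k p r n] pr len permutes_inj[OF w] k calculation(1)
    by auto
  ultimately show ?thesis
    using that[of p r] ks k by (simp add: reduced_word_iff)
qed

section \<open>A family of sections\<close>

text \<open>
  The case $q = 1$, $t = 1$ is the group of permutation matrices. The factor with \<open>t\<close> is the effect of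
  conjugation by the diagonal matrix \<open>t\<close>.
\<close>

definition std_section :: "'a \<Rightarrow> (nat \<Rightarrow> 'a) \<Rightarrow> 'g set \<Rightarrow> 'g" where
  "std_section q t K = (let w = THE w. w permutes {..n} \<and> weyl_elt w = K
     in monomial w (\<lambda>j. t (w j) / t j * q ^ later_smaller n w j))"

lemma std_section_weyl_elt:
  assumes "w permutes {..n}"
  shows "std_section q t (weyl_elt w) = monomial w (\<lambda>j. t (w j) / t j * q ^ later_smaller n w j)"
proof -
  have "(THE v. v permutes {..n} \<and> weyl_elt v = weyl_elt w) = w"
    using assms weyl_elt_inj by (intro the_equality) blast+
  then show ?thesis by (simp add: std_section_def)
qed

lemma units_std_section:
  assumes "q \<noteq> 0" "t \<in> units_upto n" "w permutes {..n}"
  shows "(\<lambda>j. t (w j) / t j * q ^ m j) \<in> units_upto n"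
  using assms permutes_in_image[OF assms(3)] by (auto simp: units_upto_def)

lemma later_smaller_simple:
  assumes "k \<in> {1..n}"
  shows "later_smaller n (s k) j = (if j = k - 1 then 1 else 0)"
  using later_smaller_ascent[of id k "k - 1" k n j] assms by simp

lemma std_section_simple:
  assumes "k \<in> {1..n}"
  shows "std_section q t (simple_refl n G \<phi> k)
    = monomial (s k) (\<lambda>j. t (s k j) / t j * (if j = k - 1 then q else 1))"
  unfolding simple_refl_eq[OF assms] std_section_weyl_elt[OF s_permutes[OF assms]] later_smaller_simple[OF assms]
  by (intro monomial_cong) simp

text \<open>
  In a reduced word every letter is an ascent, so by \<open>later_smaller_ascent\<close> it adds one factor \<open>q\<close>, in the
  column that \<open>w\<close> sends to $k - 1$. The lift of $s_k$ carries its factor \<open>q\<close> in column $k - 1$, which is the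
  same place after composition. The factors with \<open>t\<close> telescope.
\<close>

lemma std_section_is_section:
  assumes q: "q \<noteq> 0" and t: "t \<in> units_upto n"
  shows "is_section n G \<phi> (std_section q t)"
  unfolding is_section_def
proof (intro conjI ballI allI impI)
  fix K assume "K \<in> carrier (weyl n G \<phi>)"
  then obtain w where w: "w permutes {..n}" "K = weyl_elt w" by (auto simp: weyl_carrier)
  then show "std_section q t K \<in> norm_torus n G \<phi>"
    using units_std_section[OF q t w(1)] by (auto simp: std_section_weyl_elt norm_torus_iff)
  show "torus n \<phi> #> std_section q t K = K"
    using w units_std_section[OF q t w(1)] by (simp add: std_section_weyl_elt torus_coset_monomial)
next
  fix ks assume "reduced_word n G \<phi> ks"
  then show "std_section q t (weyl_word n G \<phi> ks)
      = foldr (\<otimes>) (map (\<lambda>k. std_section q t (simple_refl n G \<phi> k)) ks) \<one>"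
  proof (induction ks)
    case Nil
    have "std_section q t (weyl_elt id) = monomial id (\<lambda>_. 1)"
      unfolding std_section_weyl_elt[OF permutes_id] using t by (intro monomial_cong) (auto simp: units_upto_def)
    then show ?case by (simp add: weyl_word_eq monomial_one)
  next
    case (Cons k ks)
    obtain p r where red: "reduced_word n G \<phi> ks" and k: "k \<in> {1..n}" and ks: "set ks \<subseteq> {1..n}"
      and pr: "word_perm ks p = k - 1" "word_perm ks r = k" "p < r" "r \<le> n"
      using reduced_ConsD[OF Cons.prems] .
    let ?w = "word_perm ks"
    have w: "?w permutes {..n}" by (rule word_perm_permutes[OF ks])
    have "k \<ge> 1" using k by simp
    note asc = later_smaller_ascent[OF permutes_inj[OF w] \<open>k \<ge> 1\<close> pr]
    have wn: "t (?w j) \<noteq> 0" if "j \<le> n" for j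
      using t permutes_in_image[OF w, of j] that by (auto simp: units_upto_def)
    have "foldr (\<otimes>) (map (\<lambda>k. std_section q t (simple_refl n G \<phi> k)) (k # ks)) \<one>
        = std_section q t (weyl_elt (s k)) \<otimes> std_section q t (weyl_elt ?w)"
      using Cons.IH[OF red] by (simp add: weyl_word_eq[OF ks] simple_refl_eq[OF k])
    also have "\<dots> = monomial (s k \<circ> ?w) (\<lambda>j. (t (s k (?w j)) / t (?w j) * q ^ later_smaller n (s k) (?w j))
        * (t (?w j) / t j * q ^ later_smaller n ?w j))"
      unfolding std_section_weyl_elt[OF s_permutes[OF k]] std_section_weyl_elt[OF w]
      by (rule monomial_mult) (intro s_permutes k w units_std_section q t)+
    also have "\<dots> = std_section q t (weyl_elt (s k \<circ> ?w))"
      unfolding std_section_weyl_elt[OF permutes_compose[OF w s_permutes[OF k]]] asc later_smaller_simple[OF k]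
      using wn by (intro monomial_cong) (simp add: power_add)
    also have "\<dots> = std_section q t (weyl_word n G \<phi> (k # ks))"
      using k ks weyl_word_eq[of "k # ks"] by simp
    finally show ?case by (rule sym)
  qed
qed

text \<open>
  Every Weyl group element has a reduced word.
\<close>

lemma section_determined:
  assumes S: "is_section n G \<phi> S" "is_section n G \<phi> S'"
    and eq: "\<And>k. k \<in> {1..n} \<Longrightarrow> S (simple_refl n G \<phi> k) = S' (simple_refl n G \<phi> k)"
    and K: "K \<in> carrier (weyl n G \<phi>)"
  shows "S K = S' K"
proof -
  obtain w where w: "w permutes {..n}" "K = weyl_elt w" using K by (auto simp: weyl_carrier)
  obtain ks where ks: "set ks \<subseteq> {1..n}" "word_perm ks = w" "length ks = inversions n w"
    using exists_word_of_inversions_length[OF w(1)] by blast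
  have red: "reduced_word n G \<phi> ks" using ks by (simp add: reduced_word_iff)
  have K: "K = weyl_word n G \<phi> ks" using ks w by (simp add: weyl_word_eq)
  have "map (\<lambda>k. S (simple_refl n G \<phi> k)) ks = map (\<lambda>k. S' (simple_refl n G \<phi> k)) ks"
    using ks(1) eq by auto
  then show ?thesis using S red unfolding is_section_def K by metis
qed

section \<open>Every section belongs to the family\<close>

lemma section_simple:
  assumes "is_section n G \<phi> S" "k \<in> {1..n}"
  obtains e where "e \<in> units_upto n" "S (simple_refl n G \<phi> k) = monomial (s k) e"
proof -
  have W: "weyl_elt (s k) \<in> carrier (weyl n G \<phi>)"
    using s_permutes[OF assms(2)] by (auto simp: weyl_carrier)
  then have N: "S (weyl_elt (s k)) \<in> norm_torus n G \<phi>" and c: "torus n \<phi> #> S (weyl_elt (s k)) = weyl_elt (s k)"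
    using assms(1) by (auto simp: is_section_def)
  obtain w e where w: "w permutes {..n}" "e \<in> units_upto n" "S (weyl_elt (s k)) = monomial w e"
    using N by (auto simp: norm_torus_iff)
  then have "w = s k"
    using c s_permutes[OF assms(2)] weyl_elt_inj by (simp add: torus_coset_monomial)
  then show ?thesis using w that simple_refl_eq[OF assms(2)] by simp
qed

lemma section_word:
  assumes "is_section n G \<phi> S" "reduced_word n G \<phi> ks" "reduced_word n G \<phi> ls"
    "word_perm ks = word_perm ls"
  shows "foldr (\<otimes>) (map (\<lambda>k. S (simple_refl n G \<phi> k)) ks) \<one>
       = foldr (\<otimes>) (map (\<lambda>k. S (simple_refl n G \<phi> k)) ls) \<one>"
proof -
  have "weyl_word n G \<phi> ks = weyl_word n G \<phi> ls"
    using assms(2-) by (simp add: weyl_word_eq reduced_word_iff)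
  then show ?thesis using assms unfolding is_section_def by metis
qed

lemma reduced_singleton: "k \<in> {1..n} \<Longrightarrow> reduced_word n G \<phi> [k]"
  by (rule reduced_Cons[OF reduced_Nil, where p = "k - 1" and r = k]) auto

text \<open>
  The lifts commute in the projective group, that is, up to a scalar \<open>c\<close>. An index that neither
  reflection moves gives $c = 1$, and the index \<open>i\<close> then gives the claim.
\<close>

lemma section_commute:
  assumes S: "is_section n G \<phi> S"
    and E: "\<And>k. k \<in> {1..n} \<Longrightarrow> E k \<in> units_upto n \<and> S (simple_refl n G \<phi> k) = monomial (s k) (E k)"
    and ij: "i \<in> {1..n}" "j \<in> {1..n}" "i + 2 \<le> j \<or> j + 2 \<le> i"
  shows "E j i = E j (i - 1)"
proof -
  have sv: "s i (j - 1) = j - 1" "s i j = j" "s j (i - 1) = i - 1" "s j i = i"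
    unfolding transpose_adjacent using ij by auto
  have red: "reduced_word n G \<phi> [i, j]" "reduced_word n G \<phi> [j, i]"
    subgoal by (rule reduced_Cons[OF reduced_singleton[OF ij(2)] ij(1), of "i - 1" i]) (use sv ij in auto)
    subgoal by (rule reduced_Cons[OF reduced_singleton[OF ij(1)] ij(2), of "j - 1" j]) (use sv ij in auto)
    done
  have comm: "s i \<circ> s j = s j \<circ> s i"
  proof
    fix r
    consider "r = i - 1" | "r = i" | "r = j - 1" | "r = j" | "r \<notin> {i - 1, i, j - 1, j}" by blast
    then show "(s i \<circ> s j) r = (s j \<circ> s i) r"
      by cases (simp_all add: sv transpose_apply_other del: One_nat_def)
  qed
  note Ei = E[OF ij(1)] and Ej = E[OF ij(2)]
  note si = s_permutes[OF ij(1)] and sj = s_permutes[OF ij(2)]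
  have "monomial (s i) (E i) \<otimes> monomial (s j) (E j) = monomial (s j) (E j) \<otimes> monomial (s i) (E i)"
    using section_word[OF S red] comm Ei Ej si sj by (simp add: monomial_closed)
  then have "monomial (s i \<circ> s j) (\<lambda>r. E i (s j r) * E j r) = monomial (s j \<circ> s i) (\<lambda>r. E j (s i r) * E i r)"
    using Ei Ej si sj by (simp add: monomial_mult)
  then obtain c where c: "\<And>r. r \<le> n \<Longrightarrow> E j (s i r) * E i r = c * (E i (s j r) * E j r)"
    using monomial_eq_iff[OF permutes_compose[OF sj si] units_upto_mult[OF sj] permutes_compose[OF si sj] units_upto_mult[OF si]]
      Ei Ej by blast
  have nz: "E i r \<noteq> 0" "E j r \<noteq> 0" if "r \<le> n" for r
    using Ei Ej that by (auto simp: units_upto_def)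
  \<comment> \<open>The rank guarantees an index that neither reflection moves.\<close>
  have "\<exists>r\<le>n. r \<notin> set [i - 1, i, j - 1, j]"
  proof (rule ccontr)
    assume "\<not> ?thesis"
    then have "{..n} \<subseteq> set [i - 1, i, j - 1, j]" by auto
    then have "card {..n} \<le> length [i - 1, i, j - 1, j]"
      using card_mono[OF finite_set] card_length le_trans by blast
    then show False using rank by simp
  qed
  then obtain r where r: "r \<le> n" "r \<noteq> i - 1" "r \<noteq> i" "r \<noteq> j - 1" "r \<noteq> j" by auto
  then have "c = 1" using c[OF r(1)] nz[OF r(1)] by (simp add: transpose_def)
  then show ?thesis
    using c[of i] nz[of i] ij(1) sv(4) by (auto simp: transpose_apply_second)
qed

text \<open>
  Both sides of the braid relation are the reversal of $i - 1, i, j$. The three conclusions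
  compare coefficients at an index that is not moved, at $i - 1$ and at \<open>i\<close>; the scalar \<open>c\<close> is the same.
\<close>

lemma section_braid:
  assumes S: "is_section n G \<phi> S"
    and E: "\<And>k. k \<in> {1..n} \<Longrightarrow> E k \<in> units_upto n \<and> S (simple_refl n G \<phi> k) = monomial (s k) (E k)"
    and ij: "i \<in> {1..n}" "j \<in> {1..n}" "j = i + 1"
  obtains c where "\<And>r. r \<le> n \<Longrightarrow> r \<notin> {i - 1, i, j} \<Longrightarrow> E i r = c * E j r"
    and "E i j = c * E j (i - 1)"
    and "E i (i - 1) * E i i * E j (i - 1) = c * (E j i * E j j * E i j)"
proof -
  have i1: "i - 1 < i" "j - 1 = i" using ij by auto
  have sv: "s i (i - 1) = i" "s i i = i - 1" "s i j = j" "s j i = j" "s j j = i" "s j (i - 1) = i - 1"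
    unfolding transpose_adjacent using ij by auto
  have red2: "reduced_word n G \<phi> [i, j]" "reduced_word n G \<phi> [j, i]"
    using reduced_Cons[OF reduced_singleton[OF ij(2)] ij(1), of "i - 1" j]
      reduced_Cons[OF reduced_singleton[OF ij(1)] ij(2), of "i - 1" j] ij sv i1 by auto
  have red: "reduced_word n G \<phi> [i, j, i]" "reduced_word n G \<phi> [j, i, j]"
    using reduced_Cons[OF red2(2) ij(1), of i j] reduced_Cons[OF red2(1) ij(2), of "i - 1" i]
      ij sv i1 by auto
  have braid: "s i \<circ> (s j \<circ> s i) = s j \<circ> (s i \<circ> s j)"
  proof
    fix r
    consider "r = i - 1" | "r = i" | "r = j" | "r \<notin> {i - 1, i, j - 1, j}" using i1 by blast
    then show "(s i \<circ> (s j \<circ> s i)) r = (s j \<circ> (s i \<circ> s j)) r"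
      unfolding o_apply by cases (simp_all only: sv, simp add: transpose_apply_other)
  qed
  note Ei = conjunct1[OF E[OF ij(1)]] and Ej = conjunct1[OF E[OF ij(2)]]
  note si = s_permutes[OF ij(1)] and sj = s_permutes[OF ij(2)]
  have "monomial (s i) (E i) \<otimes> (monomial (s j) (E j) \<otimes> monomial (s i) (E i)) = monomial (s j) (E j) \<otimes> (monomial (s i) (E i) \<otimes> monomial (s j) (E j))"
    using section_word[OF S red] braid E[OF ij(1)] E[OF ij(2)] si sj by (simp add: monomial_closed)
  then have "monomial (s i \<circ> (s j \<circ> s i)) (\<lambda>r. E i ((s j \<circ> s i) r) * (E j (s i r) * E i r))
      = monomial (s j \<circ> (s i \<circ> s j)) (\<lambda>r. E j ((s i \<circ> s j) r) * (E i (s j r) * E j r))"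
    unfolding monomial_mult[OF sj Ej si Ei] monomial_mult[OF si Ei sj Ej]
      monomial_mult[OF si Ei permutes_compose[OF si sj] units_upto_mult[OF si Ej Ei]]
      monomial_mult[OF sj Ej permutes_compose[OF sj si] units_upto_mult[OF sj Ei Ej]] .
  then obtain c where c: "c \<noteq> 0" "\<And>r. r \<le> n \<Longrightarrow> E j ((s i \<circ> s j) r) * (E i (s j r) * E j r)
      = c * (E i ((s j \<circ> s i) r) * (E j (s i r) * E i r))"
    unfolding monomial_eq_iff[OF permutes_compose[OF permutes_compose[OF si sj] si]
        units_upto_mult[OF permutes_compose[OF si sj] Ei units_upto_mult[OF si Ej Ei]]
        permutes_compose[OF permutes_compose[OF sj si] sj]
        units_upto_mult[OF permutes_compose[OF sj si] Ej units_upto_mult[OF sj Ei Ej]]] by blast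
  have nz: "E i r \<noteq> 0" "E j r \<noteq> 0" if "r \<le> n" for r
    using Ei Ej that by (auto simp: units_upto_def)
  have n: "i - 1 \<le> n" "i \<le> n" "j \<le> n" using ij by auto
  have cancel: "y = inverse c * x" if "x = c * y" for x y
    using that c(1) by simp
  show ?thesis
  proof (rule that)
    fix r assume r: "r \<le> n" "r \<notin> {i - 1, i, j}"
    then have "s i r = r" "s j r = r" using i1(2) by (auto simp: transpose_def)
    then show "E i r = inverse c * E j r"
      using c(2)[OF r(1)] nz[OF r(1)] by (intro cancel) simp
  next
    show "E i j = inverse c * E j (i - 1)"
    proof -
      have "E j i * E i (i - 1) * E j (i - 1) = c * (E i j * (E j i * E i (i - 1)))"
        using c(2)[OF n(1)] unfolding o_apply sv by (simp only: mult.assoc)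
      then have "E j i * E i (i - 1) * E j (i - 1) = E j i * E i (i - 1) * (c * E i j)"
        by (simp only: ac_simps)
      then have "E j (i - 1) = c * E i j"
        using nz(1)[OF n(1)] nz(2)[OF n(2)] unfolding mult_cancel_left by simp
      then show ?thesis by (rule cancel)
    qed
  next
    show "E i (i - 1) * E i i * E j (i - 1) = inverse c * (E j i * E j j * E i j)"
    proof -
      have "E j j * (E i j * E j i) = c * (E i (i - 1) * (E j (i - 1) * E i i))"
        using c(2)[OF n(2)] unfolding o_apply sv .
      then have "E j i * E j j * E i j = c * (E i (i - 1) * E i i * E j (i - 1))"
        by (simp only: ac_simps)
      then show ?thesis by (rule cancel)
    qed
  qed
qed

text \<open>
  By \<open>section_commute\<close> the coefficients are constant to the left of $k - 1$ and to the right of \<open>k\<close>. If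
  both sides are present, \<open>section_braid\<close> with the neighbour $k + 1$ relates one coefficient on
  each side to coefficients of the neighbour, and these two lie on the same, constant, side of it.
\<close>

lemma section_constant_outside:
  assumes S: "is_section n G \<phi> S"
    and E: "\<And>k. k \<in> {1..n} \<Longrightarrow> E k \<in> units_upto n \<and> S (simple_refl n G \<phi> k) = monomial (s k) (E k)"
    and k: "k \<in> {1..n}"
  obtains a where "a \<noteq> 0" "\<And>r. r \<le> n \<Longrightarrow> r \<noteq> k - 1 \<Longrightarrow> r \<noteq> k \<Longrightarrow> E k r = a"
proof -
  note comm = section_commute[OF S E]
  have left: "E i r = E i 0" if "i \<in> {1..n}" "r + 2 \<le> i" for i r
    using that(2)
  proof (induction r)
    case (Suc r)
    then show ?case using comm[of "Suc r" i] that(1) by simp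
  qed simp
  have right: "E k r = E k (k + 1)" if "k + 1 \<le> r" "r \<le> n" for r
    using that
  proof (induction r rule: dec_induct)
    case (step r)
    then show ?case using comm[of "Suc r" k] k by simp
  qed simp
  have across: "E k (k + 1) = E k 0" if "k \<ge> 2" "k + 1 \<le> n"
  proof -
    have j: "k + 1 \<in> {1..n}" using that by simp
    obtain c where c: "\<And>r. r \<le> n \<Longrightarrow> r \<notin> {k - 1, k, k + 1} \<Longrightarrow> E k r = c * E (k + 1) r"
      "E k (k + 1) = c * E (k + 1) (k - 1)"
      using section_braid[OF S E k j refl] by metis
    have "k - 2 \<le> n" "k - 2 \<noteq> k - 1" "k - 2 \<noteq> k" "k - 2 \<noteq> k + 1"
      using that by arith+
    then have "E k (k - 2) = c * E (k + 1) (k - 2)" by (intro c(1)) auto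
    moreover have "E (k + 1) (k - 2) = E (k + 1) (k - 1)"
      using left[OF j, of "k - 2"] left[OF j, of "k - 1"] that by simp
    moreover have "E k (k - 2) = E k 0" using left[OF k, of "k - 2"] that by simp
    ultimately show ?thesis using c(2) by simp
  qed
  show ?thesis
  proof (cases "k = 1")
    case True
    show ?thesis
    proof (rule that)
      show "E k 2 \<noteq> 0" using E[OF k] rank by (simp add: units_upto_def)
      show "E k r = E k 2" if "r \<le> n" "r \<noteq> k - 1" "r \<noteq> k" for r
        using right[of r] that True by (simp add: numeral_2_eq_2)
    qed
  next
    case False
    show ?thesis
    proof (rule that)
      show "E k 0 \<noteq> 0" using E[OF k] by (simp add: units_upto_def)
      show "E k r = E k 0" if "r \<le> n" "r \<noteq> k - 1" "r \<noteq> k" for r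
      proof (cases "r < k")
        case True
        then show ?thesis using left[OF k, of r] that by simp
      next
        case False
        then show ?thesis using right[of r] across that \<open>k \<noteq> 1\<close> k by simp
      qed
    qed
  qed
qed

text \<open>
  Conjugation by \<open>t\<close> multiplies the coefficient in column \<open>k\<close> of the lift of $s_k$ by $t_{k-1}/t_k$ and the one in
  column $k - 1$ by the inverse. The coefficient in column \<open>k\<close> can be prescribed by solving for $t_k$
  recursively, and the product \<open>q\<close> then fixes the other one.
\<close>

lemma std_section_of_simple:
  assumes E: "\<And>k. k \<in> {1..n} \<Longrightarrow> E k (k - 1) * E k k = q
      \<and> (\<forall>r\<le>n. r \<noteq> k - 1 \<longrightarrow> r \<noteq> k \<longrightarrow> E k r = 1)"
    and q: "q \<noteq> 0"
  obtains t where "t \<in> units_upto n"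
    "\<And>k. k \<in> {1..n} \<Longrightarrow> std_section q t (simple_refl n G \<phi> k) = monomial (s k) (E k)"
proof -
  define t where "t r = (\<Prod>k\<in>{1..r}. inverse (E k k))" for r
  have nz: "E k k \<noteq> 0" if "k \<in> {1..n}" for k
    using E[OF that] q by auto
  have t: "t \<in> units_upto n"
    using nz by (auto simp: units_upto_def t_def)
  have "std_section q t (simple_refl n G \<phi> k) = monomial (s k) (E k)" if k: "k \<in> {1..n}" for k
  proof -
    have step: "t k = t (k - 1) * inverse (E k k)"
      using k unfolding t_def by (cases k) auto
    have tn: "t r \<noteq> 0" if "r \<le> n" for r using t that by (simp add: units_upto_def)
    have tk: "t k \<noteq> 0" "t (k - 1) \<noteq> 0" using tn k by auto
    show ?thesis
      unfolding std_section_simple[OF k]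
    proof (rule monomial_cong)
      fix r assume r: "r \<le> n"
      consider "r = k - 1" | "r = k" | "r \<noteq> k - 1" "r \<noteq> k" by blast
      then show "t (s k r) / t r * (if r = k - 1 then q else 1) = E k r"
      proof cases
        case 1
        then have "s k r = k" by simp
        then show ?thesis
        proof -
          have "q = E k (k - 1) * E k k" using E[OF k] by simp
          then show ?thesis using 1 \<open>s k r = k\<close> nz[OF k] step tk by simp
        qed
      next
        case 2
        then have "s k r = k - 1" "r \<noteq> k - 1" using k by auto
        then show ?thesis using 2 nz[OF k] step tk by (simp add: field_simps)
      next
        case 3
        then show ?thesis using E[OF k] r tn[OF r] by (simp add: transpose_def)
      qed
    qed
  qed
  then show ?thesis using that t by blast
qed

text \<open>
  Once the constant coefficients of neighbouring lifts are scaled to $1$, the scalar in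
  \<open>section_braid\<close> is $1$, so the products of the two remaining coefficients agree.
\<close>

lemma section_eq_std_section:
  assumes S: "is_section n G \<phi> S"
  obtains q t where "q \<noteq> 0" "t \<in> units_upto n" "\<And>K. K \<in> carrier (weyl n G \<phi>) \<Longrightarrow> S K = std_section q t K"
proof -
  have "\<forall>k\<in>{1..n}. \<exists>e. e \<in> units_upto n \<and> S (simple_refl n G \<phi> k) = monomial (s k) e"
    using section_simple[OF S] by metis
  then obtain D where D: "\<And>k. k \<in> {1..n} \<Longrightarrow> D k \<in> units_upto n \<and> S (simple_refl n G \<phi> k) = monomial (s k) (D k)"
    by metis
  have "\<forall>k\<in>{1..n}. \<exists>a. a \<noteq> 0 \<and> (\<forall>r\<le>n. r \<noteq> k - 1 \<longrightarrow> r \<noteq> k \<longrightarrow> D k r = a)"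
    using section_constant_outside[OF S D] by metis
  then obtain a where a: "\<And>k. k \<in> {1..n} \<Longrightarrow> a k \<noteq> 0 \<and> (\<forall>r\<le>n. r \<noteq> k - 1 \<longrightarrow> r \<noteq> k \<longrightarrow> D k r = a k)"
    by metis
  define E where "E k r = D k r / a k" for k r
  have out: "E k r = 1" if "k \<in> {1..n}" "r \<le> n" "r \<noteq> k - 1" "r \<noteq> k" for k r
    using a[OF that(1)] that by (simp add: E_def)
  have E: "E k \<in> units_upto n \<and> S (simple_refl n G \<phi> k) = monomial (s k) (E k)" if k: "k \<in> {1..n}" for k
  proof -
    have Eu: "E k \<in> units_upto n"
      using D[OF k] a[OF k] by (auto simp: E_def units_upto_def)
    have "\<forall>j\<le>n. E k j = inverse (a k) * D k j"
      by (simp add: E_def field_simps)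
    then have "monomial (s k) (D k) = monomial (s k) (E k)"
      using monomial_eq_iff[OF s_permutes[OF k] _ s_permutes[OF k] Eu] D[OF k] a[OF k]
      by (metis nonzero_imp_inverse_nonzero)
    then show ?thesis using D[OF k] Eu by simp
  qed
  have step: "E i (i - 1) * E i i = E (i + 1) i * E (i + 1) (i + 1)"
    if i: "i \<in> {1..n}" "i + 1 \<in> {1..n}" for i
  proof -
    obtain c where c: "E i (i + 1) = c * E (i + 1) (i - 1)"
      "E i (i - 1) * E i i * E (i + 1) (i - 1) = c * (E (i + 1) i * E (i + 1) (i + 1) * E i (i + 1))"
      using section_braid[OF S E i refl] by metis
    have "E i (i + 1) = 1" "E (i + 1) (i - 1) = 1" using out i by auto
    then show ?thesis using c by simp
  qed
  define q where "q = E 1 0 * E 1 1"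
  have prod: "k \<in> {1..n} \<Longrightarrow> E k (k - 1) * E k k = q" for k
  proof (induction k)
    case (Suc k)
    show ?case
    proof (cases "k = 0")
      case False
      then show ?thesis using Suc step[of k] by simp
    qed (simp add: q_def)
  qed simp
  have q: "q \<noteq> 0" using E[of 1] rank by (simp add: q_def units_upto_def)
  obtain t where t: "t \<in> units_upto n"
    "\<And>k. k \<in> {1..n} \<Longrightarrow> std_section q t (simple_refl n G \<phi> k) = monomial (s k) (E k)"
    using std_section_of_simple[of E q] prod out q by metis
  have "S K = std_section q t K" if "K \<in> carrier (weyl n G \<phi>)" for K
    by (rule section_determined[OF S std_section_is_section[OF q t(1)] _ that]) (simp add: t(2) E)
  then show ?thesis using that q t(1) by blast
qed

section \<open>Orders\<close>

lemma std_section_simple_units: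
  assumes "q \<noteq> 0" "t \<in> units_upto n" "k \<in> {1..n}"
  shows "(\<lambda>j. t (s k j) / t j * (if j = k - 1 then q else 1)) \<in> units_upto n"
  using assms permutes_in_image[OF s_permutes[OF assms(3)]] by (auto simp: units_upto_def)

lemma simple_in_carrier: "k \<in> {1..n} \<Longrightarrow> simple_refl n G \<phi> k \<in> carrier (weyl n G \<phi>)"
  using simple_refl_eq s_permutes by (auto simp: weyl_carrier)

lemma std_section_simple_closed:
  "q \<noteq> 0 \<Longrightarrow> t \<in> units_upto n \<Longrightarrow> k \<in> {1..n} \<Longrightarrow> std_section q t (simple_refl n G \<phi> k) \<in> carrier G"
  using monomial_closed[OF s_permutes std_section_simple_units] by (simp add: std_section_simple)

lemma monomial_id_power:
  assumes "e \<in> units_upto n"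
  shows "monomial id e [^] (m::nat) = monomial id (\<lambda>j. e j ^ m)"
proof (induction m)
  case (Suc m)
  have em: "(\<lambda>j. e j ^ m) \<in> units_upto n" using assms by (simp add: units_upto_def)
  have "monomial id e [^] Suc m = monomial id (\<lambda>j. e j ^ m) \<otimes> monomial id e"
    by (simp only: nat_pow_Suc Suc)
  also have "\<dots> = monomial id (\<lambda>j. e j ^ Suc m)"
    unfolding monomial_mult[OF permutes_id em permutes_id assms] id_comp
    by (intro monomial_cong) (simp add: mult.commute)
  finally show ?case .
qed (use monomial_one in \<open>simp only: nat_pow_0 power_0\<close>)

text \<open>
  Odd powers lie over a nontrivial permutation. The square is the class of the diagonal matrix with \<open>q\<close>
  at $k - 1$ and \<open>k\<close> and with $1$ elsewhere. Its powers are compared with the identity at an index outside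
  $\{k - 1, k\}$, which rules out a common scalar.
\<close>

lemma std_section_simple_power_eq_one_iff:
  assumes q: "q \<noteq> 0" and t: "t \<in> units_upto n" and k: "k \<in> {1..n}"
  shows "std_section q t (simple_refl n G \<phi> k) [^] (m::nat) = \<one> \<longleftrightarrow> even m \<and> q ^ (m div 2) = 1"
proof -
  define e where "e = (\<lambda>j. t (s k j) / t j * (if j = k - 1 then q else 1))"
  define x where "x = monomial (s k) e"
  define d where "d = (\<lambda>j. if j = k - 1 \<or> j = k then q else 1)"
  have x: "std_section q t (simple_refl n G \<phi> k) = x" by (simp add: std_section_simple[OF k] x_def e_def)
  note sk = s_permutes[OF k]
  have e: "e \<in> units_upto n" unfolding e_def by (rule std_section_simple_units[OF q t k])
  have d: "d \<in> units_upto n" using q by (simp add: d_def units_upto_def)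
  have dp: "(\<lambda>j. d j ^ m) \<in> units_upto n" for m using d by (simp add: units_upto_def)
  have xc: "x \<in> carrier G" unfolding x_def by (rule monomial_closed[OF sk e])
  have tn: "t r \<noteq> 0" if "r \<le> n" for r using t that by (simp add: units_upto_def)
  have kn: "k \<le> n" "k - 1 \<le> n" "k - 1 \<noteq> k" using k by auto
  have "x [^] (2::nat) = x \<otimes> x" using xc by (simp add: numeral_2_eq_2)
  also have "\<dots> = monomial (s k \<circ> s k) (\<lambda>j. e (s k j) * e j)"
    unfolding x_def by (rule monomial_mult[OF sk e sk e])
  also have "\<dots> = monomial id d"
  proof (unfold transpose_comp_involutory, rule monomial_cong)
    fix j assume that: "j \<le> n"
    consider "j = k - 1" | "j = k" | "j \<noteq> k - 1" "j \<noteq> k" by blast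
    then show "e (s k j) * e j = d j"
      using tn[OF that] tn[OF kn(1)] tn[OF kn(2)] kn(3) unfolding e_def d_def
      by cases (simp_all add: transpose_apply_other del: One_nat_def)
  qed
  finally have sq: "x [^] (2::nat) = monomial id d" .
  have even: "x [^] (2 * j) = monomial id (\<lambda>i. d i ^ j)" for j :: nat
    using nat_pow_pow[OF xc, of 2 j] sq monomial_id_power[OF d, of j] by simp
  have one_iff: "monomial id (\<lambda>i. d i ^ j) = \<one> \<longleftrightarrow> q ^ j = 1" for j :: nat
  proof
    assume "monomial id (\<lambda>i. d i ^ j) = \<one>"
    then obtain c where c: "\<And>i. i \<le> n \<Longrightarrow> 1 = c * d i ^ j"
      using monomial_eq_iff[OF permutes_id dp permutes_id units_const_1] unfolding monomial_one by blast
    \<comment> \<open>an index outside $\{k - 1, k\}$\<close>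
    define r where "r = (if k = 1 then 2 else 0::nat)"
    have "r \<le> n" "r \<noteq> k - 1" "r \<noteq> k" using k rank by (auto simp: r_def)
    then have "c = 1" using c[of r] by (simp add: d_def)
    then show "q ^ j = 1" using c[OF kn(1)] by (simp add: d_def)
  next
    assume "q ^ j = 1"
    then have "(\<lambda>i. d i ^ j) = (\<lambda>_. 1)" by (auto simp: d_def)
    then show "monomial id (\<lambda>i. d i ^ j) = \<one>" by (simp add: monomial_one)
  qed
  show ?thesis
  proof (cases "even m")
    case True
    then obtain j where m: "m = 2 * j" by (rule evenE)
    have "m div 2 = j" using m by simp
    then show ?thesis unfolding x using even[of j] one_iff[of j] True m by metis
  next
    case False
    then obtain j where m: "m = 2 * j + 1" by (rule oddE)
    have "x [^] m = monomial id (\<lambda>i. d i ^ j) \<otimes> x"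
      using xc even[of j] by (simp add: m)
    also have "\<dots> = monomial (s k) (\<lambda>i. d (s k i) ^ j * e i)"
      unfolding x_def monomial_mult[OF permutes_id dp sk e] id_comp ..
    finally have xm: "x [^] m = monomial (s k) (\<lambda>i. d (s k i) ^ j * e i)" .
    have "s k \<noteq> id" using kn(3) by (metis id_apply transpose_apply_first)
    then have "x [^] m \<noteq> \<one>"
      unfolding xm monomial_one[symmetric]
      using monomial_eq_iff[OF sk units_upto_mult[OF sk dp[of j] e] permutes_id units_const_1] by blast
    then show ?thesis using x False by simp
  qed
qed

lemma ord_std_section_simple:
  assumes q: "q \<noteq> 0" and t: "t \<in> units_upto n" and k: "k \<in> {1..n}"
    and m: "primitive_root_of_unity m q"
  shows "ord (std_section q t (simple_refl n G \<phi> k)) = 2 * m"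
proof -
  have "even l \<and> m dvd l div 2 \<longleftrightarrow> 2 * m dvd l" for l
  proof (cases "even l")
    case True
    then obtain j where "l = 2 * j" by auto
    then show ?thesis by simp
  next
    case False
    then show ?thesis by (metis dvd_mult_left)
  qed
  then show ?thesis
    unfolding ord_unique[OF std_section_simple_closed[OF q t k]] std_section_simple_power_eq_one_iff[OF q t k]
      primitive_root_power_eq_1_iff[OF m] by blast
qed

lemma section_ord_uniform:
  assumes S: "is_section n G \<phi> S" and kl: "k \<in> {1..n}" "l \<in> {1..n}"
  shows "ord (S (simple_refl n G \<phi> k)) = ord (S (simple_refl n G \<phi> l))"
    and "ord (S (simple_refl n G \<phi> k)) \<noteq> 1"
proof -
  obtain q t where q: "q \<noteq> 0" and t: "t \<in> units_upto n"
    and eq: "\<And>K. K \<in> carrier (weyl n G \<phi>) \<Longrightarrow> S K = std_section q t K"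
    using section_eq_std_section[OF S] by metis
  have "ord (std_section q t (simple_refl n G \<phi> k)) = ord (std_section q t (simple_refl n G \<phi> l))"
    unfolding ord_unique[OF std_section_simple_closed[OF q t kl(1)]] std_section_simple_power_eq_one_iff[OF q t kl(1)]
      pow_eq_id[OF std_section_simple_closed[OF q t kl(2)], symmetric] std_section_simple_power_eq_one_iff[OF q t kl(2)]
    by blast
  then show "ord (S (simple_refl n G \<phi> k)) = ord (S (simple_refl n G \<phi> l))"
    unfolding eq[OF simple_in_carrier[OF kl(1)]] eq[OF simple_in_carrier[OF kl(2)]] .
  have "\<not> ord (std_section q t (simple_refl n G \<phi> k)) dvd 1"
    unfolding pow_eq_id[OF std_section_simple_closed[OF q t kl(1)], symmetric] std_section_simple_power_eq_one_iff[OF q t kl(1)]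
    by simp
  then show "ord (S (simple_refl n G \<phi> k)) \<noteq> 1"
    unfolding eq[OF simple_in_carrier[OF kl(1)]] by simp
qed

section \<open>Optimal sections\<close>

lemma order_profile_apply:
  "k \<in> {1..n} \<Longrightarrow> order_profile n G \<phi> S k
    = (if ord (S (simple_refl n G \<phi> k)) = 0 then \<infinity> else enat (ord (S (simple_refl n G \<phi> k))))"
  by (simp add: order_profile_def Let_def)

text \<open>
  No lift has order $1$, so nothing lies above a profile that is constantly $2$. Any other
  maximal profile has a value at most $2$ at some node, hence, the orders being equal at all
  nodes, it is constantly $2$ as well.
\<close>

lemma involutive_profile_optimal:
  assumes S: "is_section n G \<phi> S" and two: "\<And>k. k \<in> {1..n} \<Longrightarrow> ord (S (simple_refl n G \<phi> k)) = 2"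
  shows "optimal_section n G \<phi> S"
proof -
  have one: "1 \<in> {1..n}" using rank by simp
  have P2: "order_profile n G \<phi> S k = 2" if "k \<in> {1..n}" for k
    using two[OF that] by (simp add: order_profile_apply[OF that] numeral_eq_enat)
  have "\<not> profile_less n (order_profile n G \<phi> S) (order_profile n G \<phi> S')"
    if S': "is_section n G \<phi> S'" for S'
  proof
    assume "profile_less n (order_profile n G \<phi> S) (order_profile n G \<phi> S')"
    then have "order_profile n G \<phi> S' 1 < 2"
      using P2[OF one] one by (metis profile_less_def)
    then show False
      using section_ord_uniform(2)[OF S' one one]
      unfolding order_profile_apply[OF one] numeral_eq_enat by (simp split: if_splits)
  qed
  then have max: "maximal_profile n G \<phi> (order_profile n G \<phi> S)"
    using S by (auto simp: maximal_profile_def)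
  moreover have "P = order_profile n G \<phi> S" if P: "maximal_profile n G \<phi> P" for P
  proof -
    obtain S' where S': "is_section n G \<phi> S'" "order_profile n G \<phi> S' = P"
      using P unfolding maximal_profile_def by blast
    have "\<not> profile_less n P (order_profile n G \<phi> S)"
      using P S unfolding maximal_profile_def by blast
    then obtain k where k: "k \<in> {1..n}" "\<not> P k > order_profile n G \<phi> S k"
      unfolding profile_less_def by blast
    then have "order_profile n G \<phi> S' k \<le> 2"
      unfolding S'(2) P2[OF k(1)] not_less by simp
    then have "ord (S' (simple_refl n G \<phi> k)) = 2"
      using section_ord_uniform(2)[OF S'(1) k(1) k(1)]
      unfolding order_profile_apply[OF k(1)] numeral_eq_enat by (simp split: if_splits)
    then have two': "ord (S' (simple_refl n G \<phi> l)) = 2" if "l \<in> {1..n}" for l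
      using section_ord_uniform(1)[OF S'(1) that k(1)] by (rule trans[rotated])
    show ?thesis
      unfolding S'(2)[symmetric] order_profile_def by (rule restrict_ext) (simp only: two two')
  qed
  ultimately show ?thesis using S unfolding optimal_section_def by blast
qed

lemma primitive_root_1: "primitive_root_of_unity 1 (1::'a)"
  by (auto simp: primitive_root_of_unity_def)

lemma optimal_ord:
  assumes S: "optimal_section n G \<phi> S" and k: "k \<in> {1..n}"
  shows "ord (S (simple_refl n G \<phi> k)) = 2"
proof -
  let ?S = "std_section 1 (\<lambda>_. 1)"
  have two: "ord (?S (simple_refl n G \<phi> l)) = 2" if "l \<in> {1..n}" for l
    using ord_std_section_simple[OF one_neq_zero units_const_1 that primitive_root_1] unfolding mult_1_right .
  have "optimal_section n G \<phi> ?S"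
    by (rule involutive_profile_optimal[OF std_section_is_section[OF one_neq_zero units_const_1] two])
  then have "order_profile n G \<phi> ?S = order_profile n G \<phi> S"
    using S unfolding optimal_section_def by blast
  then have "order_profile n G \<phi> S k = order_profile n G \<phi> ?S k" by simp
  then show ?thesis
    using two[OF k] by (auto simp: order_profile_apply[OF k] split: if_splits)
qed

lemma std_section_1_homomorphic:
  assumes S: "is_section n G \<phi> S" and t: "t \<in> units_upto n"
    and eq: "\<And>K. K \<in> carrier (weyl n G \<phi>) \<Longrightarrow> S K = std_section 1 t K"
  shows "homomorphic_section n G \<phi> S"
proof -
  have SW: "S (weyl_elt w) = monomial w (\<lambda>j. t (w j) / t j)" if "w permutes {..n}" for w
    using eq[of "weyl_elt w"] that by (simp add: weyl_carrier std_section_weyl_elt)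
  have tu: "(\<lambda>j. t (w j) / t j) \<in> units_upto n" if "w permutes {..n}" for w
    using units_std_section[OF one_neq_zero t that, of "\<lambda>_. 0"] by simp
  have "S (K \<otimes>\<^bsub>weyl n G \<phi>\<^esub> Y) = S K \<otimes> S Y"
    if KY: "K \<in> carrier (weyl n G \<phi>)" "Y \<in> carrier (weyl n G \<phi>)" for K Y
  proof -
    obtain w v where w: "w permutes {..n}" "K = weyl_elt w" and v: "v permutes {..n}" "Y = weyl_elt v"
      using KY by (auto simp: weyl_carrier)
    have "t (v j) \<noteq> 0" if "j \<le> n" for j
      using t permutes_in_image[OF v(1), of j] that by (auto simp: units_upto_def)
    then have "monomial (w \<circ> v) (\<lambda>j. t ((w \<circ> v) j) / t j) = monomial (w \<circ> v) (\<lambda>j. t (w (v j)) / t (v j) * (t (v j) / t j))"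
      by (intro monomial_cong) simp
    then show ?thesis
      unfolding w(2) v(2) weyl_mult[OF w(1) v(1)] SW[OF permutes_compose[OF v(1) w(1)]]
        SW[OF w(1)] SW[OF v(1)] monomial_mult[OF w(1) tu[OF w(1)] v(1) tu[OF v(1)]] .
  qed
  then show ?thesis
    using S by (auto simp: homomorphic_section_def hom_def is_section_def)
qed

section \<open>Coordinates\<close>

lemma torus_point_eq_prod:
  assumes x: "\<And>k. k \<in> {1..n} \<Longrightarrow> x k \<noteq> 0"
  shows "torus_point n G \<phi> x = monomial id (\<lambda>r. \<Prod>k\<in>{r<..n}. x k)"
proof -
  have u: "(\<lambda>r. if r < k then x k else 1) \<in> units_upto n" if "k \<in> {1..n}" for k
    using x[OF that] by (simp add: units_upto_def)
  have fold: "foldr (\<otimes>) (map (\<lambda>k. fund_coweight n \<phi> k (x k)) ks) \<one>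
      = monomial id (\<lambda>r. \<Prod>k\<leftarrow>ks. if r < k then x k else 1)
    \<and> (\<lambda>r. \<Prod>k\<leftarrow>ks. if r < k then x k else 1) \<in> units_upto n" if "set ks \<subseteq> {1..n}" for ks
    using that
  proof (induction ks)
    case (Cons k ks)
    have ks: "set ks \<subseteq> {1..n}" and k: "k \<in> {1..n}" using Cons.prems by auto
    note IH = conjunct1[OF Cons.IH[OF ks]] and us = conjunct2[OF Cons.IH[OF ks]] and uk = u[OF k]
    have "foldr (\<otimes>) (map (\<lambda>k. fund_coweight n \<phi> k (x k)) (k # ks)) \<one>
        = monomial id (\<lambda>r. if r < k then x k else 1) \<otimes> monomial id (\<lambda>r. \<Prod>k\<leftarrow>ks. if r < k then x k else 1)"
      by (simp only: list.map foldr.simps o_apply IH) (simp only: fund_coweight_def tor_eq_monomial)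
    also have "\<dots> = monomial id (\<lambda>r. \<Prod>k\<leftarrow>k # ks. if r < k then x k else 1)"
      unfolding monomial_mult[OF permutes_id uk permutes_id us] id_comp by (intro monomial_cong) simp
    finally have eq: "foldr (\<otimes>) (map (\<lambda>k. fund_coweight n \<phi> k (x k)) (k # ks)) \<one>
        = monomial id (\<lambda>r. \<Prod>k\<leftarrow>k # ks. if r < k then x k else 1)" .
    moreover have "(\<lambda>r. \<Prod>k\<leftarrow>k # ks. if r < k then x k else 1) \<in> units_upto n"
      using units_upto_mult[OF permutes_id uk us] by simp
    ultimately show ?case by (rule conjI)
  qed (simp add: monomial_one)
  have "set [1..<n + 1] \<subseteq> {1..n}" by auto
  then have "torus_point n G \<phi> x = monomial id (\<lambda>r. \<Prod>k\<leftarrow>[1..<n + 1]. if r < k then x k else 1)"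
    unfolding torus_point_def by (rule conjunct1[OF fold])
  also have "\<dots> = monomial id (\<lambda>r. \<Prod>k\<in>{r<..n}. x k)"
  proof (rule monomial_cong)
    fix r :: nat
    have "(\<Prod>k\<leftarrow>[1..<n + 1]. if r < k then x k else 1) = (\<Prod>k\<in>{1..<n + 1}. if r < k then x k else 1)"
      by (simp only: prod.distinct_set_conv_list[OF distinct_upt, symmetric] set_upt)
    also have "\<dots> = (\<Prod>k\<in>{r<..n}. x k)"
      by (rule prod.mono_neutral_cong_right) auto
    finally show "(\<Prod>k\<leftarrow>[1..<n + 1]. if r < k then x k else 1) = (\<Prod>k\<in>{r<..n}. x k)" .
  qed
  finally show ?thesis .
qed

text \<open>
  The coordinates of a diagonal matrix are the quotients of successive entries. Stated as a
  recursion this spares evaluating the product of fundamental coweights.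
\<close>

lemma torus_point_eqI:
  assumes d: "d \<in> units_upto n" and x: "\<And>r. r < n \<Longrightarrow> d r = x (r + 1) * d (r + 1)"
  shows "torus_point n G \<phi> x = monomial id d"
proof -
  have dn: "d r \<noteq> 0" if "r \<le> n" for r using d that by (simp add: units_upto_def)
  have xn: "x k \<noteq> 0" if "k \<in> {1..n}" for k
  proof -
    have "k - 1 < n" "k - 1 + 1 = k" using that by auto
    then show ?thesis using x[of "k - 1"] dn[of "k - 1"] by auto
  qed
  let ?P = "\<lambda>r. \<Prod>k\<in>{r<..n}. x k"
  have P: "?P \<in> units_upto n"
    using xn by (auto simp: units_upto_def)
  have "d r = d n * ?P r" if "r \<le> n" for r
    using that
  proof (induction r rule: inc_induct)
    case (step r)
    then have "{r<..n} = insert (Suc r) {Suc r<..n}" by auto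
    then have "?P r = x (Suc r) * ?P (Suc r)" by simp
    then show ?case using x[of r] step by simp
  qed simp
  then have "monomial id ?P = monomial id d"
    using monomial_eq_iff[OF permutes_id P permutes_id d] dn[of n] by blast
  moreover have "torus_point n G \<phi> x = monomial id ?P" by (rule torus_point_eq_prod) (rule xn)
  ultimately show ?thesis by simp
qed

lemma torus_coord_monomial:
  assumes d: "d \<in> units_upto n" and k: "k \<in> {1..n}"
  shows "torus_coord n G \<phi> k (monomial id d) = d (k - 1) / d k"
  unfolding torus_coord_def
proof (rule the_equality)
  have dn: "d r \<noteq> 0" if "r \<le> n" for r using d that by (simp add: units_upto_def)
  have "torus_point n G \<phi> (\<lambda>j. d (j - 1) / d j) = monomial id d"
    using dn by (intro torus_point_eqI d) simp
  moreover have "\<forall>j\<in>{1..n}. d (j - 1) / d j \<noteq> 0" using dn by auto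
  ultimately show "\<exists>x. (\<forall>j\<in>{1..n}. x j \<noteq> 0) \<and> torus_point n G \<phi> x = monomial id d \<and> x k = d (k - 1) / d k"
    by (intro exI[of _ "\<lambda>j. d (j - 1) / d j"]) simp
next
  fix c assume "\<exists>x. (\<forall>j\<in>{1..n}. x j \<noteq> 0) \<and> torus_point n G \<phi> x = monomial id d \<and> x k = c"
  then obtain x where x: "\<And>j. j \<in> {1..n} \<Longrightarrow> x j \<noteq> 0" "torus_point n G \<phi> x = monomial id d" "x k = c" by blast
  let ?P = "\<lambda>r. \<Prod>k\<in>{r<..n}. x k"
  have P: "?P \<in> units_upto n" using x(1) by (auto simp: units_upto_def)
  have "torus_point n G \<phi> x = monomial id ?P" by (rule torus_point_eq_prod) (rule x(1))
  then have "monomial id ?P = monomial id d" using x(2) by simp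
  then obtain b where b: "b \<noteq> 0" "\<And>r. r \<le> n \<Longrightarrow> d r = b * ?P r"
    using monomial_eq_iff[OF permutes_id P permutes_id d] by blast
  have "k - 1 \<le> n" using k by auto
  have "{k - 1<..n} = insert k {k<..n}" using k by auto
  then have "?P (k - 1) = c * ?P k" using x(3) by simp
  moreover have "?P k \<noteq> 0" using x(1) by auto
  ultimately show "c = d (k - 1) / d k"
    using b(1) b(2)[of k] b(2)[OF \<open>k - 1 \<le> n\<close>] k by (simp add: field_simps)
qed

text \<open>
  The representative is scaled to be $1$ outside the two indices that $s_i$ moves. For $i = n$ this divides
  the matrix by its value on the indices below $n - 1$, which is why inverses appear.
\<close>

lemma t_coords_point:
  assumes a: "nonzero_params n a" and i: "i \<in> {1..n}"
  obtains d where "d \<in> units_upto n" "torus_point n G \<phi> (t_coords n a i) = monomial id d"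
    "\<And>r. r \<noteq> i - 1 \<Longrightarrow> r \<noteq> i \<Longrightarrow> d r = 1"
    "d (i - 1) * d i = (if i < n then a i i * (a i (i + 1))\<^sup>2
       else inverse (a n n) * inverse ((a n (n - 1))\<^sup>2))"
proof (cases "i < n")
  case True
  have nz: "a i i \<noteq> 0" "a i (i + 1) \<noteq> 0" using a i True by (auto simp: nonzero_params_def)
  define d where "d = (\<lambda>_. 1)(i - 1 := a i i * a i (i + 1), i := a i (i + 1))"
  have ne: "i - 1 \<noteq> i" using i by auto
  show ?thesis
  proof (rule that)
    show du: "d \<in> units_upto n" using nz by (simp add: d_def units_upto_def)
    show "d r = 1" if "r \<noteq> i - 1" "r \<noteq> i" for r using that by (simp add: d_def)
    show "torus_point n G \<phi> (t_coords n a i) = monomial id d"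
    proof (rule torus_point_eqI[OF du])
      fix r assume "r < n"
      consider "r + 1 = i - 1" | "r + 1 = i" | "r = i" | "r + 1 \<noteq> i - 1" "r + 1 \<noteq> i" "r \<noteq> i"
        by blast
      then show "d r = t_coords n a i (r + 1) * d (r + 1)"
      proof cases
        case 1
        then show ?thesis using nz i True by (auto simp: d_def t_coords_def field_simps)
      next
        case 2
        then have "r = i - 1" by simp
        then show ?thesis using nz i True 2 by (auto simp: d_def t_coords_def numeral_2_eq_2)
      next
        case 3
        then show ?thesis using nz i True by (auto simp: d_def t_coords_def numeral_2_eq_2)
      next
        case 4
        then have "r \<noteq> i - 1" using i by auto
        then show ?thesis using 4 nz i True by (auto simp: d_def t_coords_def numeral_2_eq_2)
      qed
    qed
    show "d (i - 1) * d i = (if i < n then a i i * (a i (i + 1))\<^sup>2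
       else inverse (a n n) * inverse ((a n (n - 1))\<^sup>2))"
      using ne True by (simp add: d_def power2_eq_square)
  qed
next
  case False
  then have "i = n" using i by simp
  have nz: "a n n \<noteq> 0" "a n (n - 1) \<noteq> 0" using a rank by (auto simp: nonzero_params_def)
  define d where "d = (\<lambda>_. 1)(n - 1 := inverse (a n (n - 1)), n := inverse (a n n * a n (n - 1)))"
  have ne: "n - 1 \<noteq> n" "n \<noteq> 1" using rank by auto
  show ?thesis
  proof (rule that)
    show du: "d \<in> units_upto n" using nz by (simp add: d_def units_upto_def)
    show "d r = 1" if "r \<noteq> i - 1" "r \<noteq> i" for r using that \<open>i = n\<close> by (simp add: d_def)
    show "torus_point n G \<phi> (t_coords n a i) = monomial id d"
    proof (rule torus_point_eqI[OF du])
      fix r assume "r < n"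
      then consider "r + 1 = n - 1" | "r + 1 = n" | "r + 1 < n - 1" by linarith
      then show "d r = t_coords n a i (r + 1) * d (r + 1)"
      proof cases
        case 1
        then show ?thesis using nz ne \<open>i = n\<close> by (auto simp: d_def t_coords_def numeral_2_eq_2)
      next
        case 2
        then have "r = n - 1" by simp
        then show ?thesis using nz ne \<open>i = n\<close> 2 by (auto simp: d_def t_coords_def numeral_2_eq_2)
      next
        case 3
        then show ?thesis using nz ne \<open>i = n\<close> by (auto simp: d_def t_coords_def numeral_2_eq_2)
      qed
    qed
    show "d (i - 1) * d i = (if i < n then a i i * (a i (i + 1))\<^sup>2
       else inverse (a n n) * inverse ((a n (n - 1))\<^sup>2))"
      using ne nz \<open>i = n\<close> by (simp add: d_def power2_eq_square)
  qed
qed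

lemma section_given_by_eq_std_section:
  assumes a: "nonzero_params n a" and z: "\<And>i. i \<in> {1..<n} \<Longrightarrow> - (a i i * (a i (i + 1))\<^sup>2) = z"
    "- (inverse (a n n) * inverse ((a n (n - 1))\<^sup>2)) = z"
  obtains t where "z \<noteq> 0" "t \<in> units_upto n"
    "\<And>i. i \<in> {1..n} \<Longrightarrow>
       torus_point n G \<phi> (t_coords n a i) \<otimes> simple_sigma G u i = std_section z t (simple_refl n G \<phi> i)"
proof -
  have "z \<noteq> 0" using z(2) a rank by (auto simp: nonzero_params_def)
  have "\<forall>i\<in>{1..n}. \<exists>e. torus_point n G \<phi> (t_coords n a i) \<otimes> simple_sigma G u i = monomial (s i) e
      \<and> e (i - 1) * e i = z \<and> (\<forall>r. r \<noteq> i - 1 \<longrightarrow> r \<noteq> i \<longrightarrow> e r = 1)"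
  proof
    fix i assume i: "i \<in> {1..n}"
    obtain d where d: "d \<in> units_upto n" "torus_point n G \<phi> (t_coords n a i) = monomial id d"
      "\<And>r. r \<noteq> i - 1 \<Longrightarrow> r \<noteq> i \<Longrightarrow> d r = 1"
      "d (i - 1) * d i = (if i < n then a i i * (a i (i + 1))\<^sup>2
         else inverse (a n n) * inverse ((a n (n - 1))\<^sup>2))"
      using t_coords_point[OF a i] by metis
    have dz: "d (i - 1) * d i = - z"
    proof (cases "i < n")
      case True
      then have "d (i - 1) * d i = a i i * (a i (i + 1))\<^sup>2" using d(4) by simp
      moreover have "i \<in> {1..<n}" using True i by simp
      ultimately show ?thesis using z(1) by (metis minus_minus)
    next
      case False
      then have "d (i - 1) * d i = inverse (a n n) * inverse ((a n (n - 1))\<^sup>2)" using d(4) by simp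
      then show ?thesis using z(2) by (metis minus_minus)
    qed
    obtain f where f: "f \<in> units_upto n" "f (i - 1) * f i = - 1"
      "\<And>r. r \<noteq> i - 1 \<Longrightarrow> r \<noteq> i \<Longrightarrow> f r = 1" "simple_sigma G u i = monomial (s i) f"
      using simple_sigma_eq_monomial[OF i] by metis
    let ?e = "\<lambda>r. d (s i r) * f r"
    have "?e (i - 1) * ?e i = (d (i - 1) * d i) * (f (i - 1) * f i)" by (simp add: ac_simps)
    also have "\<dots> = z" unfolding dz f(2) by simp
    finally have "?e (i - 1) * ?e i = z" .
    moreover have "?e r = 1" if "r \<noteq> i - 1" "r \<noteq> i" for r
      using that d(3) f(3) by (simp add: transpose_def)
    moreover have "torus_point n G \<phi> (t_coords n a i) \<otimes> simple_sigma G u i = monomial (s i) ?e"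
      using monomial_mult[OF permutes_id d(1) s_permutes[OF i] f(1)] d(2) f(4) by simp
    ultimately show "\<exists>e. torus_point n G \<phi> (t_coords n a i) \<otimes> simple_sigma G u i = monomial (s i) e
      \<and> e (i - 1) * e i = z \<and> (\<forall>r. r \<noteq> i - 1 \<longrightarrow> r \<noteq> i \<longrightarrow> e r = 1)" by blast
  qed
  then obtain E where E: "\<And>i. i \<in> {1..n} \<Longrightarrow>
      torus_point n G \<phi> (t_coords n a i) \<otimes> simple_sigma G u i = monomial (s i) (E i)
      \<and> E i (i - 1) * E i i = z \<and> (\<forall>r. r \<noteq> i - 1 \<longrightarrow> r \<noteq> i \<longrightarrow> E i r = 1)"
    by metis
  obtain t where "t \<in> units_upto n"
    "\<And>i. i \<in> {1..n} \<Longrightarrow> std_section z t (simple_refl n G \<phi> i) = monomial (s i) (E i)"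
    using std_section_of_simple[of E z] E \<open>z \<noteq> 0\<close> by metis
  then show ?thesis using that E \<open>z \<noteq> 0\<close> by metis
qed

text \<open>
  The Tits lifts have $q = -1$ for every realization; the realization only affects \<open>t\<close>.
\<close>

lemma simple_sigma_eq_std_section:
  obtains t where "t \<in> units_upto n"
    "\<And>i. i \<in> {1..n} \<Longrightarrow> simple_sigma G u i = std_section (- 1) t (simple_refl n G \<phi> i)"
proof -
  have "\<forall>i\<in>{1..n}. \<exists>e. simple_sigma G u i = monomial (s i) e
      \<and> e (i - 1) * e i = - 1 \<and> (\<forall>r. r \<noteq> i - 1 \<longrightarrow> r \<noteq> i \<longrightarrow> e r = 1)"
    using simple_sigma_eq_monomial by metis
  then obtain E where E: "\<And>i. i \<in> {1..n} \<Longrightarrow> simple_sigma G u i = monomial (s i) (E i)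
      \<and> E i (i - 1) * E i i = - 1 \<and> (\<forall>r. r \<noteq> i - 1 \<longrightarrow> r \<noteq> i \<longrightarrow> E i r = 1)"
    by metis
  obtain t where "t \<in> units_upto n"
    "\<And>i. i \<in> {1..n} \<Longrightarrow> std_section (- 1) t (simple_refl n G \<phi> i) = monomial (s i) (E i)"
    using std_section_of_simple[of E "- 1"] E by (metis neg_equal_0_iff_equal zero_neq_one)
  then show ?thesis using that E by metis
qed

text \<open>
  If the torus part of the lift of $s_1$ is $\mathrm{diag}(d_0, d_1, 1, \dots, 1)$, then
  $a_{1,1} = d_0/d_1$ and $a_{1,2} = d_1$, so $a_{1,1} a_{1,2}^2 = d_0 d_1$. This is the quotient of \<open>q\<close> by the value $-1$
  for the Tits lift.
\<close>

lemma section_param_std_section: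
  assumes q: "q \<noteq> 0" and t: "t \<in> units_upto n"
    and S: "S (simple_refl n G \<phi> 1) = std_section q t (simple_refl n G \<phi> 1)"
  shows "section_param n G \<phi> u S 1 1 * (section_param n G \<phi> u S 1 2)\<^sup>2 = - q"
proof -
  have k: "1 \<in> {1..n}" "2 \<in> {1..n}" using rank by auto
  obtain f where f: "f \<in> units_upto n" "f (1 - 1) * f 1 = - 1"
      "\<And>r. r \<noteq> 1 - 1 \<Longrightarrow> r \<noteq> 1 \<Longrightarrow> f r = 1" "simple_sigma G u 1 = monomial (s 1) f"
    using simple_sigma_eq_monomial[OF k(1)] by metis
  define e where "e = (\<lambda>j. t (s 1 j) / t j * (if j = 1 - 1 then q else 1))"
  have e: "e \<in> units_upto n" unfolding e_def by (rule std_section_simple_units[OF q t k(1)])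
  define d where "d j = e (s 1 j) / f (s 1 j)" for j
  note s1 = s_permutes[OF k(1)]
  have d: "d \<in> units_upto n"
    using e f(1) permutes_in_image[OF s1] by (auto simp: d_def units_upto_def)
  have "S (simple_refl n G \<phi> 1) = monomial (s 1) e" unfolding S std_section_simple[OF k(1)] e_def ..
  also have "\<dots> = monomial id d \<otimes> simple_sigma G u 1"
    unfolding f(4) monomial_mult[OF permutes_id d s1 f(1)] id_comp
    using f(1) by (intro monomial_cong) (simp add: d_def units_upto_def)
  finally have "S (simple_refl n G \<phi> 1) = monomial id d \<otimes> simple_sigma G u 1" .
  moreover have "monomial id d \<in> carrier G" "simple_sigma G u 1 \<in> carrier G"
    unfolding f(4) by (intro monomial_closed permutes_id d s1 f(1))+
  ultimately have "S (simple_refl n G \<phi> 1) \<otimes> inv (simple_sigma G u 1) = monomial id d"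
    by (simp add: m_assoc)
  then have p: "section_param n G \<phi> u S 1 1 = d 0 / d 1" "section_param n G \<phi> u S 1 2 = d 1 / d 2"
    using torus_coord_monomial[OF d k(1)] torus_coord_monomial[OF d k(2)] by (simp_all add: section_param_def)
  have tn: "t 0 \<noteq> 0" "t 1 \<noteq> 0" "t 2 \<noteq> 0" using t rank by (auto simp: units_upto_def)
  have s1v: "s 1 0 = 1" "s 1 1 = 0" "s 1 2 = 2" by (auto simp: transpose_def)
  have d2: "d 2 = 1"
    using f(3)[of 2] tn by (simp add: d_def s1v e_def)
  have "e 0 * e 1 = q" using tn by (simp add: e_def s1v)
  moreover have "d 0 * d 1 = (e 0 * e 1) / (f (1 - 1) * f 1)"
    by (simp add: d_def s1v mult.commute)
  ultimately have "d 0 * d 1 = - q" using f(2) by simp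
  moreover have "d 1 \<noteq> 0" using d rank by (simp add: units_upto_def)
  ultimately show ?thesis
    unfolding p d2 by (simp add: power2_eq_square)
qed

lemma std_section_conjugate:
  assumes q: "q \<noteq> 0" and t: "t \<in> units_upto n" and x: "x \<in> units_upto n"
    and K: "K \<in> carrier (weyl n G \<phi>)"
  shows "monomial id x \<otimes> std_section q t K \<otimes> inv (monomial id x) = std_section q (\<lambda>j. x j * t j) K"
proof -
  obtain w where w: "w permutes {..n}" "K = weyl_elt w" using K by (auto simp: weyl_carrier)
  show ?thesis
    unfolding w(2) std_section_weyl_elt[OF w(1)] monomial_conj_torus[OF w(1) units_std_section[OF q t w(1)] x]
    by (intro monomial_cong) simp
qed

text \<open>
  Conjugation changes \<open>t\<close> but not \<open>q\<close>, and any two choices of \<open>t\<close> are related by a torus element.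
\<close>

lemma T_conjugate_iff_section_param:
  assumes S: "is_section n G \<phi> S" and S': "is_section n G \<phi> S'"
  shows "T_conjugate n G \<phi> S S' \<longleftrightarrow>
    section_param n G \<phi> u S 1 1 * (section_param n G \<phi> u S 1 2)\<^sup>2
      = section_param n G \<phi> u S' 1 1 * (section_param n G \<phi> u S' 1 2)\<^sup>2"
proof -
  obtain q t where q: "q \<noteq> 0" and t: "t \<in> units_upto n"
    and eq: "\<And>K. K \<in> carrier (weyl n G \<phi>) \<Longrightarrow> S K = std_section q t K"
    using section_eq_std_section[OF S] by metis
  obtain q' t' where q': "q' \<noteq> 0" and t': "t' \<in> units_upto n"
    and eq': "\<And>K. K \<in> carrier (weyl n G \<phi>) \<Longrightarrow> S' K = std_section q' t' K"
    using section_eq_std_section[OF S'] by metis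
  have "1 \<in> {1..n}" using rank by simp
  note s1 = simple_in_carrier[OF this]
  note param = section_param_std_section[OF q t, of S, OF eq[OF s1]]
  note param' = section_param_std_section[OF q' t', of S', OF eq'[OF s1]]
  show ?thesis
  proof
    assume "T_conjugate n G \<phi> S S'"
    then obtain x where x: "x \<in> units_upto n"
      "\<And>K. K \<in> carrier (weyl n G \<phi>) \<Longrightarrow> monomial id x \<otimes> S K \<otimes> inv (monomial id x) = S' K"
      by (auto simp: T_conjugate_def torus_eq)
    have xt: "(\<lambda>j. x j * t j) \<in> units_upto n" using x t by (simp add: units_upto_def)
    have "S' (simple_refl n G \<phi> 1) = std_section q (\<lambda>j. x j * t j) (simple_refl n G \<phi> 1)"
      using x(2)[OF s1] std_section_conjugate[OF q t x(1) s1] eq[OF s1] by simp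
    from section_param_std_section[OF q xt, of S', OF this]
    show "section_param n G \<phi> u S 1 1 * (section_param n G \<phi> u S 1 2)\<^sup>2
      = section_param n G \<phi> u S' 1 1 * (section_param n G \<phi> u S' 1 2)\<^sup>2"
      using param by simp
  next
    assume "section_param n G \<phi> u S 1 1 * (section_param n G \<phi> u S 1 2)\<^sup>2
      = section_param n G \<phi> u S' 1 1 * (section_param n G \<phi> u S' 1 2)\<^sup>2"
    then have "q = q'" using param param' by simp
    define x where "x j = t' j / t j" for j
    have x: "x \<in> units_upto n" using t t' by (simp add: units_upto_def x_def)
    have "monomial id x \<otimes> S K \<otimes> inv (monomial id x) = S' K" if K: "K \<in> carrier (weyl n G \<phi>)" for K
    proof -
      obtain w where w: "w permutes {..n}" "K = weyl_elt w" using K by (auto simp: weyl_carrier)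
      have "std_section q (\<lambda>j. x j * t j) K = std_section q t' K"
        unfolding w(2) std_section_weyl_elt[OF w(1)]
        using t permutes_in_image[OF w(1)] by (intro monomial_cong) (auto simp: x_def units_upto_def)
      then show ?thesis
        using std_section_conjugate[OF q t x K] eq[OF K] eq'[OF K] \<open>q = q'\<close> by simp
    qed
    then show "T_conjugate n G \<phi> S S'"
      using x unfolding T_conjugate_def torus_eq by blast
  qed
qed

lemma exists_section_of_order:
  assumes "m > 0" "of_nat m \<noteq> (0::'a)"
  shows "\<exists>S. is_section n G \<phi> S \<and> (\<forall>i\<in>{1..n}. ord (S (simple_refl n G \<phi> i)) = 2 * m)"
proof -
  obtain z :: 'a where z: "primitive_root_of_unity m z"
    using exists_primitive_root[OF assms] by blast
  have "z \<noteq> 0" using z by (auto simp: primitive_root_of_unity_def power_0_left split: if_splits)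
  then show ?thesis
    using std_section_is_section[OF _ units_const_1] ord_std_section_simple[OF _ units_const_1 _ z] by blast
qed

section \<open>Sections with prescribed parameters\<close>

lemma section_given_by_iff_std_section:
  assumes a: "nonzero_params n a"
    and z: "\<forall>i\<in>{1..<n}. - (a i i * (a i (i + 1))\<^sup>2) = z"
      "- (inverse (a n n) * inverse ((a n (n - 1))\<^sup>2)) = z"
  obtains t where "z \<noteq> 0" "t \<in> units_upto n"
    "\<And>S. section_given_by n G \<phi> u a S \<longleftrightarrow> is_section n G \<phi> S
      \<and> (\<forall>i\<in>{1..n}. S (simple_refl n G \<phi> i) = std_section z t (simple_refl n G \<phi> i))"
proof -
  obtain t where t: "z \<noteq> 0" "t \<in> units_upto n"
    "\<And>i. i \<in> {1..n} \<Longrightarrow> torus_point n G \<phi> (t_coords n a i) \<otimes> simple_sigma G u i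
      = std_section z t (simple_refl n G \<phi> i)"
    using section_given_by_eq_std_section[OF a _ z(2)] z(1) by metis
  show ?thesis
    by (rule that[OF t(1,2)]) (simp add: section_given_by_def t(3))
qed

lemma section_given_by_order:
  assumes a: "nonzero_params n a" and m: "primitive_root_of_unity m z"
    and z: "\<forall>i\<in>{1..<n}. - (a i i * (a i (i + 1))\<^sup>2) = z"
      "- (inverse (a n n) * inverse ((a n (n - 1))\<^sup>2)) = z"
  shows "(\<exists>S. section_given_by n G \<phi> u a S) \<and>
    (\<forall>S. section_given_by n G \<phi> u a S \<longrightarrow> (\<forall>i\<in>{1..n}. ord (S (simple_refl n G \<phi> i)) = 2 * m))"
proof -
  obtain t where t: "z \<noteq> 0" "t \<in> units_upto n"
    and iff: "\<And>S. section_given_by n G \<phi> u a S \<longleftrightarrow> is_section n G \<phi> S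
      \<and> (\<forall>i\<in>{1..n}. S (simple_refl n G \<phi> i) = std_section z t (simple_refl n G \<phi> i))"
    using section_given_by_iff_std_section[OF a z] by metis
  have "section_given_by n G \<phi> u a (std_section z t)"
    using std_section_is_section[OF t] iff by blast
  moreover have "ord (S (simple_refl n G \<phi> i)) = 2 * m"
    if "section_given_by n G \<phi> u a S" "i \<in> {1..n}" for S i
    using that iff ord_std_section_simple[OF t that(2) m] by metis
  ultimately show ?thesis by blast
qed

lemma section_given_by_optimal_homomorphic:
  assumes a: "nonzero_params n a" "\<forall>i\<in>{1..<n}. a i i * (a i (i + 1))\<^sup>2 = - 1"
    "a n n * (a n (n - 1))\<^sup>2 = - 1"
  shows "(\<exists>S. section_given_by n G \<phi> u a S) \<and>
    (\<forall>S. section_given_by n G \<phi> u a S \<longrightarrow> optimal_section n G \<phi> S \<and> homomorphic_section n G \<phi> S)"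
proof -
  have "- (inverse (a n n) * inverse ((a n (n - 1))\<^sup>2)) = - inverse (a n n * (a n (n - 1))\<^sup>2)"
    by (simp only: inverse_mult_distrib)
  also have "\<dots> = 1" unfolding a(3) by simp
  finally have z: "\<forall>i\<in>{1..<n}. - (a i i * (a i (i + 1))\<^sup>2) = 1"
    "- (inverse (a n n) * inverse ((a n (n - 1))\<^sup>2)) = 1"
    using a(2) by simp_all
  note order = section_given_by_order[OF a(1) primitive_root_1 z, unfolded mult_1_right]
  obtain t where t: "t \<in> units_upto n"
    and iff: "\<And>S. section_given_by n G \<phi> u a S \<longleftrightarrow> is_section n G \<phi> S
      \<and> (\<forall>i\<in>{1..n}. S (simple_refl n G \<phi> i) = std_section 1 t (simple_refl n G \<phi> i))"
    using section_given_by_iff_std_section[OF a(1) z] by metis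
  have "optimal_section n G \<phi> S \<and> homomorphic_section n G \<phi> S"
    if given: "section_given_by n G \<phi> u a S" for S
  proof
    have S: "is_section n G \<phi> S"
      and gen: "\<And>i. i \<in> {1..n} \<Longrightarrow> S (simple_refl n G \<phi> i) = std_section 1 t (simple_refl n G \<phi> i)"
      using given unfolding iff by blast+
    have "ord (S (simple_refl n G \<phi> i)) = 2" if "i \<in> {1..n}" for i
      using order given that by blast
    then show "optimal_section n G \<phi> S"
      by (rule involutive_profile_optimal[OF S])
    have "S K = std_section 1 t K" if "K \<in> carrier (weyl n G \<phi>)" for K
      by (rule section_determined[OF S std_section_is_section[OF one_neq_zero t] _ that]) (rule gen)
    then show "homomorphic_section n G \<phi> S"
      by (rule std_section_1_homomorphic[OF S t])
  qed
  then show ?thesis using order by blast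
qed

lemma exists_Tits_section: "\<exists>S. is_Tits_section n G \<phi> u S"
proof -
  obtain t where t: "t \<in> units_upto n"
    "\<And>i. i \<in> {1..n} \<Longrightarrow> simple_sigma G u i = std_section (- 1) t (simple_refl n G \<phi> i)"
    using simple_sigma_eq_std_section by metis
  have "(- 1 :: 'a) \<noteq> 0" by simp
  then have "is_Tits_section n G \<phi> u (std_section (- 1) t)"
    using std_section_is_section[OF _ t(1)] t(2) by (simp add: is_Tits_section_def)
  then show ?thesis by blast
qed

lemma Tits_section_square:
  assumes two: "(2::'a) \<noteq> 0" and S: "is_Tits_section n G \<phi> u S" and i: "i \<in> {1..n}"
  shows "S (simple_refl n G \<phi> i) [^] (2::nat) \<noteq> \<one>"
proof -
  obtain t where t: "t \<in> units_upto n"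
    "\<And>i. i \<in> {1..n} \<Longrightarrow> simple_sigma G u i = std_section (- 1) t (simple_refl n G \<phi> i)"
    using simple_sigma_eq_std_section by metis
  have "(- 1 :: 'a) \<noteq> 1" using two by (metis add.right_inverse one_add_one)
  moreover have "S (simple_refl n G \<phi> i) = std_section (- 1) t (simple_refl n G \<phi> i)"
    using S i t(2) by (simp add: is_Tits_section_def)
  moreover have "(- 1 :: 'a) \<noteq> 0" by simp
  ultimately show ?thesis
    using std_section_simple_power_eq_one_iff[OF _ t(1) i, of "- 1" 2] by simp
qed

lemma Tits_section_not_optimal:
  assumes two: "(2::'a) \<noteq> 0" and S: "is_Tits_section n G \<phi> u S"
  shows "\<not> optimal_section n G \<phi> S"
proof
  assume opt: "optimal_section n G \<phi> S"
  have i: "1 \<in> {1..n}" using rank by simp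
  have "is_section n G \<phi> S" using S by (simp add: is_Tits_section_def)
  then obtain e where "e \<in> units_upto n" "S (simple_refl n G \<phi> 1) = monomial (s 1) e"
    using section_simple[OF _ i] by metis
  then have "S (simple_refl n G \<phi> 1) \<in> carrier G"
    using monomial_closed[OF s_permutes[OF i]] by simp
  then have "S (simple_refl n G \<phi> 1) [^] (2::nat) = \<one>"
    using pow_ord_eq_1 optimal_ord[OF opt i] by metis
  then show False using Tits_section_square[OF two S i] by blast
qed

end

theorem proposition3p5:
  fixes n :: nat
    and G :: "'g monoid"
    and \<phi> :: "'a::alg_closed_field mat set \<Rightarrow> 'g"
    and u :: "nat \<Rightarrow> nat \<Rightarrow> 'a \<Rightarrow> 'g"
  assumes "n \<ge> 6"
    and "adjoint_type_A n G \<phi>"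
    and "realization n G \<phi> u"
  shows
    "(\<forall>m>0. (of_nat m :: 'a) \<noteq> 0 \<longrightarrow>
        (\<exists>S. is_section n G \<phi> S \<and>
             (\<forall>i\<in>{1..n}. group.ord G (S (simple_refl n G \<phi> i)) = 2 * m)))
   \<and> (\<forall>m>0. \<forall>a z. nonzero_params n a \<and> primitive_root_of_unity m z \<and>
        (\<forall>i\<in>{1..<n}. - (a i i * (a i (i + 1))\<^sup>2) = z) \<and>
        - (inverse (a n n) * inverse ((a n (n - 1))\<^sup>2)) = z \<longrightarrow>
        (\<exists>S. section_given_by n G \<phi> u a S) \<and>
        (\<forall>S. section_given_by n G \<phi> u a S \<longrightarrow>
             (\<forall>i\<in>{1..n}. group.ord G (S (simple_refl n G \<phi> i)) = 2 * m)))
   \<and> (\<forall>a. nonzero_params n a \<and>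
        (\<forall>i\<in>{1..<n}. a i i * (a i (i + 1))\<^sup>2 = - 1) \<and>
        a n n * (a n (n - 1))\<^sup>2 = - 1 \<longrightarrow>
        (\<exists>S. section_given_by n G \<phi> u a S) \<and>
        (\<forall>S. section_given_by n G \<phi> u a S \<longrightarrow>
             optimal_section n G \<phi> S \<and> homomorphic_section n G \<phi> S))
   \<and> (\<exists>S. is_Tits_section n G \<phi> u S)
   \<and> ((2 :: 'a) \<noteq> 0 \<longrightarrow>
        (\<forall>S. is_Tits_section n G \<phi> u S \<longrightarrow>
             \<not> optimal_section n G \<phi> S \<and>
             (\<forall>i\<in>{1..n}. S (simple_refl n G \<phi> i) [^]\<^bsub>G\<^esub> (2::nat) \<noteq> \<one>\<^bsub>G\<^esub>)))
   \<and> (\<forall>S S'. is_section n G \<phi> S \<and> is_section n G \<phi> S' \<longrightarrow>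
        (T_conjugate n G \<phi> S S' \<longleftrightarrow>
           section_param n G \<phi> u S 1 1 * (section_param n G \<phi> u S 1 2)\<^sup>2
             = section_param n G \<phi> u S' 1 1 * (section_param n G \<phi> u S' 1 2)\<^sup>2))"
proof -
  interpret realized_A n G \<phi> u
    using assms by unfold_locales
  show ?thesis
  proof (intro conjI, goal_cases)
    case 1
    show ?case using exists_section_of_order by blast
  next
    case 2
    show ?case using section_given_by_order by blast
  next
    case 3
    show ?case using section_given_by_optimal_homomorphic by blast
  next
    case 4
    show ?case by (rule exists_Tits_section)
  next
    case 5
    show ?case using Tits_section_not_optimal Tits_section_square by blast
  next
    case 6
    show ?case using T_conjugate_iff_section_param by blast
  qed
qed

end
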